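(* Let $X,Y$ be complex Banach spaces and let $A\in\mathcal{L}(X,Y)$ and $B,C\in\mathcal{L}(Y,X)$ be such that $A(BA)^2=ABACA=ACABA=(AC)^2A$. Then $$\sigma_{\beta_\epsilon}(AC)=\sigma_{\beta_\epsilon}(BA).$$ In particular, $AC$ satisfies property $(\beta_\epsilon)$ if and only if $BA$ satisfies property $(\beta_\epsilon)$.
   Context: $\mathcal{L}(X,Y)$ is the set of bounded linear operators from $X$ to $Y$, and $\mathcal{L}(X)=\mathcal{L}(X,X)$. For an open set $V\subseteq\mathbb{C}$, $\mathcal{E}(V,X)$ is the Fréchet space of all $X$-valued $C^\infty$-functions on $V$ (with $\mathbb{C}\cong\mathbb{R}^2$; topology of uniform convergence of all partial derivatives on compact subsets of $V$). An operator $T\in\mathcal{L}(X)$ satisfies property $(\beta_\epsilon)$ at $\lambda\in\mathbb{C}$ if there is an open disc $U$ centered at $\lambda$ such that for every open subset $V\subset U$ and every sequence $(f_n)_n$ in $\mathcal{E}(V,X)$: if $(T-\mu)f_n(\mu)\to 0$ in $\mathcal{E}(V,X)$ then $f_n(\mu)\to 0$ in $\mathcal{E}(V,X)$. $\sigma_{\beta_\epsilon}(T)$ is the set of all points of $\mathbb{C}$ where $T$ fails to satisfy property $(\beta_\epsilon)$, and $T$ satisfies property $(\beta_\epsilon)$ if $\sigma_{\beta_\epsilon}(T)=\emptyset$. *)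

theory Defs
  imports "HOL-Analysis.Analysis"
begin

section \<open>Complex Banach spaces and their bounded operators\<close>

class scaleC =
  fixes scaleC :: "complex \<Rightarrow> 'a \<Rightarrow> 'a"  (infixr \<open>*\<^sub>C\<close> 75)

text \<open>The real structure inherited from \<^class>\<open>real_normed_vector\<close> is required to be the
  restriction of the complex one.\<close>

class complex_normed_vector = real_normed_vector + scaleC +
  assumes scaleC_add_right: "c *\<^sub>C (x + y) = c *\<^sub>C x + c *\<^sub>C y"
    and scaleC_add_left: "(c + d) *\<^sub>C x = c *\<^sub>C x + d *\<^sub>C x"
    and scaleC_scaleC: "c *\<^sub>C d *\<^sub>C x = (c * d) *\<^sub>C x"
    and scaleC_of_real: "complex_of_real r *\<^sub>C x = r *\<^sub>R x"
    and norm_scaleC: "norm (c *\<^sub>C x) = cmod c * norm x"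

class complex_banach = complex_normed_vector + banach

instantiation complex :: complex_banach
begin

definition scaleC_complex :: "complex \<Rightarrow> complex \<Rightarrow> complex"
  where "scaleC_complex c x = c * x"

instance
  by standard (simp_all add: scaleC_complex_def algebra_simps norm_mult scaleR_conv_of_real)

end

definition bounded_clinear ::
    "('a::complex_normed_vector \<Rightarrow> 'b::complex_normed_vector) \<Rightarrow> bool"
  where "bounded_clinear T \<longleftrightarrow> bounded_linear T \<and> (\<forall>c x. T (c *\<^sub>C x) = c *\<^sub>C T x)"


section \<open>The space of smooth vector-valued functions on an open set of the plane\<close>

text \<open>Under the identification of the complex plane with the real plane, the partial derivatives
  with respect to the two real coordinates are the derivatives in the directions \<open>1\<close> and \<open>\<i>\<close>.
  A function on \<open>V\<close> is represented by a total function whose values outside \<open>V\<close> play no role: for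
  open \<open>V\<close>, derivatives at points of \<open>V\<close> depend only on the values on \<open>V\<close>.\<close>

definition partial_deriv :: "complex \<Rightarrow> (complex \<Rightarrow> 'a::real_normed_vector) \<Rightarrow> complex \<Rightarrow> 'a"
  where "partial_deriv v f z = vector_derivative (\<lambda>t. f (z + complex_of_real t * v)) (at 0)"

definition has_partial_deriv_at ::
    "complex \<Rightarrow> (complex \<Rightarrow> 'a::real_normed_vector) \<Rightarrow> complex \<Rightarrow> bool"
  where "has_partial_deriv_at v f z \<longleftrightarrow> (\<lambda>t. f (z + complex_of_real t * v)) differentiable (at 0)"

primrec partial_derivs ::
    "complex list \<Rightarrow> (complex \<Rightarrow> 'a::real_normed_vector) \<Rightarrow> complex \<Rightarrow> 'a"
where
  "partial_derivs [] f = f"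
| "partial_derivs (v # vs) f = partial_deriv v (partial_derivs vs f)"

definition smooth_functions :: "complex set \<Rightarrow> (complex \<Rightarrow> 'a::real_normed_vector) set"
  where "smooth_functions V =
    {f. \<forall>vs \<in> lists {1, \<i>}. continuous_on V (partial_derivs vs f) \<and>
          (\<forall>v \<in> {1, \<i>}. \<forall>z \<in> V. has_partial_deriv_at v (partial_derivs vs f) z)}"

text \<open>Convergence of sequences in the Frechet topology of \<^term>\<open>smooth_functions V\<close>.\<close>

definition smooth_tendsto ::
    "complex set \<Rightarrow> (nat \<Rightarrow> complex \<Rightarrow> 'a::real_normed_vector) \<Rightarrow> (complex \<Rightarrow> 'a) \<Rightarrow> bool"
  where "smooth_tendsto V f g \<longleftrightarrow>
    (\<forall>K. compact K \<and> K \<subseteq> V \<longrightarrow>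
      (\<forall>vs \<in> lists {1, \<i>}.
        uniform_limit K (\<lambda>n. partial_derivs vs (f n)) (partial_derivs vs g) sequentially))"


section \<open>Property beta-epsilon\<close>

definition property_beta_eps_at :: "('a::complex_normed_vector \<Rightarrow> 'a) \<Rightarrow> complex \<Rightarrow> bool"
  where "property_beta_eps_at T z \<longleftrightarrow>
    (\<exists>r>0. \<forall>V. open V \<and> V \<subseteq> ball z r \<longrightarrow>
      (\<forall>f. (\<forall>n. f n \<in> smooth_functions V) \<longrightarrow>
        smooth_tendsto V (\<lambda>n \<mu>. T (f n \<mu>) - \<mu> *\<^sub>C f n \<mu>) (\<lambda>_. 0) \<longrightarrow>
        smooth_tendsto V f (\<lambda>_. 0)))"

definition sigma_beta_eps :: "('a::complex_normed_vector \<Rightarrow> 'a) \<Rightarrow> complex set"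
  where "sigma_beta_eps T = {z. \<not> property_beta_eps_at T z}"

definition property_beta_eps :: "('a::complex_normed_vector \<Rightarrow> 'a) \<Rightarrow> bool"
  where "property_beta_eps T \<longleftrightarrow> sigma_beta_eps T = {}"

end

theory Submission
  imports Defs
begin

text \<open>
  The algebra is short.  The hypotheses say that \<open>ABABA = ABACA = ACABA = ACACA\<close>, so
  \<open>S = ABA\<close> satisfies \<open>(AC) S = S (BA)\<close> and \<open>B S = (BA)\<^sup>2\<close>, while \<open>S = BACAC\<close> satisfies
  \<open>(BA) S = S (AC)\<close> and \<open>A S = (AC)\<^sup>3\<close>.  Both inclusions of the theorem are therefore instances of
  one statement about operators with \<open>R S = S T\<close> and \<open>W S = T ^^ k\<close>: property beta-epsilon passes
  from \<open>R\<close> to \<open>T\<close> at every point (\<open>property_beta_eps_at_transfer\<close>).  Indeed, if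
  \<open>(T - \<mu>) f\<^sub>n \<rightarrow> 0\<close>, then \<open>(R - \<mu>) S f\<^sub>n = S (T - \<mu>) f\<^sub>n \<rightarrow> 0\<close>, hence \<open>S f\<^sub>n \<rightarrow> 0\<close> and
  \<open>T ^^ k f\<^sub>n = W S f\<^sub>n \<rightarrow> 0\<close>.  Since \<open>\<mu> (T ^^ k f\<^sub>n) = T ^^ Suc k f\<^sub>n - T ^^ k ((T - \<mu>) f\<^sub>n)\<close>, the
  powers of \<open>T\<close> can be removed one at a time as soon as the factor \<open>\<mu>\<close> can be cancelled.

  The analytic heart is this cancellation, \<open>null_smooth_divide\<close>: if \<open>z f\<^sub>n \<rightarrow> 0\<close> with all partial
  derivatives, locally uniformly, then so does \<open>f\<^sub>n\<close>, even on a neighbourhood of \<open>0\<close>.  Write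
  \<open>\<partial>\<close> and \<open>\<partial>'\<close> for the Wirtinger derivatives with respect to \<open>z\<close> and its conjugate \<open>z'\<close>.  As
  \<open>z \<partial>' f = \<partial>' (z f)\<close>, the hypothesis passes from \<open>f\<^sub>n\<close> to \<open>\<partial>' f\<^sub>n\<close>, and it remains to treat
  \<open>u = \<partial>\<^sup>a f\<close>.  The product rule \<open>\<partial>\<^sup>a (z f) = z \<partial>\<^sup>a f + a \<partial>\<^sup>a\<^sup>-\<^sup>1 f\<close> and the decomposition
  \<open>E = z \<partial> + z' \<partial>'\<close> of the Euler field give
  \<open>(a + 1) u + E u = \<partial>\<^sup>a\<^sup>+\<^sup>1 (z f) + z' \<partial>' u\<close>.  The last term is harmless because
  \<open>\<bar>z' \<partial>' u\<bar> = \<bar>z \<partial>\<^sup>a (\<partial>' f)\<bar> = \<bar>\<partial>\<^sup>a (z \<partial>' f) - a \<partial>\<^sup>a\<^sup>-\<^sup>1 (\<partial>' f)\<bar>\<close>, which is small by induction on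
  \<open>a\<close>.  Finally \<open>(a + 1) u + E u\<close> controls \<open>u\<close> on a disc about \<open>0\<close>: along each radius it is
  \<open>t\<^sup>-\<^sup>a\<close> times the derivative of \<open>t\<^sup>a\<^sup>+\<^sup>1 u(t z)\<close>.  Away from \<open>0\<close> one simply divides by \<open>z\<close>.
\<close>

section \<open>Complex scalar multiplication\<close>

lemma bounded_bilinear_scaleC:
  "bounded_bilinear (scaleC :: complex \<Rightarrow> 'a::complex_normed_vector \<Rightarrow> 'a)"
proof
  fix a a' :: complex and b b' :: 'a and r :: real
  show "(a + a') *\<^sub>C b = a *\<^sub>C b + a' *\<^sub>C b" by (rule scaleC_add_left)
  show "a *\<^sub>C (b + b') = a *\<^sub>C b + a *\<^sub>C b'" by (rule scaleC_add_right)
  show "(r *\<^sub>R a) *\<^sub>C b = r *\<^sub>R a *\<^sub>C b"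
    by (simp add: scaleR_conv_of_real scaleC_scaleC[symmetric] scaleC_of_real)
  show "a *\<^sub>C r *\<^sub>R b = r *\<^sub>R a *\<^sub>C b"
    by (simp add: scaleC_of_real[symmetric] scaleC_scaleC mult.commute)
  show "\<exists>K. \<forall>a (b :: 'a). norm (a *\<^sub>C b) \<le> norm a * norm b * K"
    by (rule exI[of _ 1]) (simp add: norm_scaleC)
qed

lemmas bounded_linear_scaleC = bounded_bilinear.bounded_linear_right[OF bounded_bilinear_scaleC]

lemmas scaleC_zero_left = bounded_bilinear.zero_left[OF bounded_bilinear_scaleC]

lemma scaleC_one: "1 *\<^sub>C x = (x :: 'a::complex_normed_vector)"
  using scaleC_of_real[of 1 x] by simp

section \<open>Partial derivatives of smooth functions\<close>

definition has_pd ::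
    "(complex \<Rightarrow> 'a::real_normed_vector) \<Rightarrow> complex \<Rightarrow> 'a \<Rightarrow> complex \<Rightarrow> bool"
  where "has_pd f v D z \<longleftrightarrow> ((\<lambda>t. f (z + of_real t * v)) has_vector_derivative D) (at 0)"

lemma has_pd_imp:
  assumes "has_pd f v D z"
  shows "partial_deriv v f z = D" "has_partial_deriv_at v f z"
  using assms by (auto simp: has_pd_def partial_deriv_def has_partial_deriv_at_def
      vector_derivative_at differentiableI_vector)

lemma has_pd_partial_deriv:
  "has_partial_deriv_at v f z \<Longrightarrow> has_pd f v (partial_deriv v f z) z"
  by (simp add: has_pd_def partial_deriv_def has_partial_deriv_at_def vector_derivative_works)

lemma has_pd_transform:
  assumes "has_pd f v D z" "open V" "z \<in> V" and eq: "\<And>w. w \<in> V \<Longrightarrow> f w = g w"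
  shows "has_pd g v D z"
proof -
  let ?c = "\<lambda>t::real. z + of_real t * v"
  have "isCont ?c 0" by (intro continuous_intros)
  then have "eventually (\<lambda>t. ?c t \<in> V) (nhds 0)"
    using \<open>open V\<close> \<open>z \<in> V\<close>
    by (auto simp: continuous_at_imp_continuous_at_within tendsto_def isCont_def
        eventually_nhds_conv_at)
  then have "eventually (\<lambda>t. f (?c t) = g (?c t)) (nhds 0)"
    by eventually_elim (rule eq)
  then show ?thesis
    using assms(1) eq[OF \<open>z \<in> V\<close>] unfolding has_pd_def
    by (subst has_vector_derivative_cong_ev[symmetric]) (auto elim: eventually_mono)
qed

lemma has_pd_add: "has_pd f v D z \<Longrightarrow> has_pd g v E z \<Longrightarrow> has_pd (\<lambda>z. f z + g z) v (D + E) z"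
  unfolding has_pd_def by (rule has_vector_derivative_add)

lemma has_pd_linear: "bounded_linear T \<Longrightarrow> has_pd f v D z \<Longrightarrow> has_pd (\<lambda>z. T (f z)) v (T D) z"
  unfolding has_pd_def by (rule bounded_linear.has_vector_derivative)

lemma has_pd_mult:
  fixes f :: "complex \<Rightarrow> 'a::complex_normed_vector"
  assumes "has_pd f v D z"
  shows "has_pd (\<lambda>z. z *\<^sub>C f z) v (v *\<^sub>C f z + z *\<^sub>C D) z"
proof -
  have "((\<lambda>t. z + of_real t * v) has_vector_derivative v) (at 0)"
    by (auto intro!: derivative_eq_intros simp: has_vector_derivative_def scaleR_conv_of_real)
  then have "((\<lambda>t. (z + of_real t * v) *\<^sub>C f (z + of_real t * v)) has_vector_derivative
      ((z + of_real 0 * v) *\<^sub>C D + v *\<^sub>C f (z + of_real 0 * v))) (at 0)"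
    using assms unfolding has_pd_def
    by (rule bounded_bilinear.has_vector_derivative[OF bounded_bilinear_scaleC])
  then show ?thesis by (simp add: has_pd_def add.commute)
qed

lemma has_pd_along_line:
  assumes "has_pd f v D (z + of_real s * v)"
  shows "((\<lambda>t. f (z + of_real t * v)) has_vector_derivative D) (at s)"
proof -
  have "((\<lambda>t. t - s) has_vector_derivative 1) (at s)"
    by (auto intro!: derivative_eq_intros simp: has_vector_derivative_def)
  from vector_diff_chain_at[OF this,
      of "\<lambda>t. f (z + of_real s * v + of_real t * v)" D] assms
  show ?thesis by (simp add: has_pd_def o_def algebra_simps)
qed

text \<open>Smoothness is the largest property of functions that implies continuity and passes to the
  partial derivatives.  Closure properties of the space of smooth functions follow by exhibiting a
  suitable family \<open>F\<close>, without any formula for iterated derivatives.\<close>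

lemma smooth_functions_coinduct:
  assumes "open V" "f \<in> F"
    and cont: "\<And>g. g \<in> F \<Longrightarrow> continuous_on V g"
    and step: "\<And>g v. g \<in> F \<Longrightarrow> v \<in> {1, \<i>} \<Longrightarrow> \<exists>g'\<in>F. \<forall>z\<in>V. has_pd g v (g' z) z"
  shows "f \<in> smooth_functions V"
proof -
  have derivs: "\<exists>g'\<in>F. \<forall>z\<in>V. partial_derivs vs g z = g' z"
    if "vs \<in> lists {1, \<i>}" "g \<in> F" for vs g
    using that
  proof (induction vs)
    case (Cons v vs)
    then obtain g' where g': "g' \<in> F" "\<And>z. z \<in> V \<Longrightarrow> partial_derivs vs g z = g' z" by auto
    obtain g'' where g'': "g'' \<in> F" "\<And>z. z \<in> V \<Longrightarrow> has_pd g' v (g'' z) z"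
      using step[OF g'(1), of v] Cons.hyps by blast
    have "has_pd (partial_derivs vs g) v (g'' z) z" if "z \<in> V" for z
      using has_pd_transform[OF g''(2)[OF that] \<open>open V\<close> that] g'(2) by simp
    then show ?case using g''(1) by (auto intro!: bexI[of _ g''] has_pd_imp(1))
  qed auto
  show ?thesis
    unfolding smooth_functions_def
  proof (intro CollectI ballI conjI)
    fix vs assume vs: "vs \<in> lists {1, \<i>}"
    obtain g where g: "g \<in> F" "\<And>z. z \<in> V \<Longrightarrow> partial_derivs vs f z = g z"
      using derivs[OF vs \<open>f \<in> F\<close>] by blast
    show "continuous_on V (partial_derivs vs f)"
      using cont[OF g(1)] g(2) by (simp cong: continuous_on_cong)
    fix v z assume v: "v \<in> {1, \<i>}" and z: "z \<in> V"
    obtain g' where "\<And>z. z \<in> V \<Longrightarrow> has_pd g v (g' z) z" using step[OF g(1) v] by blast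
    from has_pd_transform[OF this[OF z] \<open>open V\<close> z] g(2)
    show "has_partial_deriv_at v (partial_derivs vs f) z"
      using has_pd_imp(2) by metis
  qed
qed

lemma partial_derivs_append:
  "partial_derivs (vs @ ws) f = partial_derivs vs (partial_derivs ws f)"
  by (induction vs) auto

lemma smooth_functionsD:
  assumes "f \<in> smooth_functions V" "vs \<in> lists {1, \<i>}"
  shows "continuous_on V (partial_derivs vs f)"
    and "\<And>v z. v \<in> {1, \<i>} \<Longrightarrow> z \<in> V \<Longrightarrow> has_partial_deriv_at v (partial_derivs vs f) z"
  using assms unfolding smooth_functions_def by blast+

lemma smooth_continuous: "f \<in> smooth_functions V \<Longrightarrow> continuous_on V f"
  using smooth_functionsD(1)[of f V "[]"] by simp

lemma smooth_has_pd:
  "f \<in> smooth_functions V \<Longrightarrow> v \<in> {1, \<i>} \<Longrightarrow> z \<in> V \<Longrightarrow> has_pd f v (partial_deriv v f z) z"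
  using smooth_functionsD(2)[of f V "[]" v z] by (simp add: has_pd_partial_deriv)

lemma smooth_partial_deriv:
  assumes "f \<in> smooth_functions V" "v \<in> {1, \<i>}"
  shows "partial_deriv v f \<in> smooth_functions V"
proof -
  have "partial_derivs vs (partial_deriv v f) = partial_derivs (vs @ [v]) f" for vs
    by (simp add: partial_derivs_append)
  moreover have "vs @ [v] \<in> lists {1, \<i>}" if "vs \<in> lists {1, \<i>}" for vs
    using assms(2) that by simp
  ultimately show ?thesis
    unfolding smooth_functions_def
    by (intro CollectI ballI conjI) (simp_all only: smooth_functionsD[OF assms(1)])
qed

lemma smooth_cong:
  assumes "open V" "f \<in> smooth_functions V" "\<And>z. z \<in> V \<Longrightarrow> f z = g z"
  shows "g \<in> smooth_functions V"
proof (rule smooth_functions_coinduct[OF \<open>open V\<close>])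
  let ?F = "{g. \<exists>f\<in>smooth_functions V. \<forall>z\<in>V. f z = g z}"
  show "g \<in> ?F" using assms(2,3) by blast
  fix g :: "complex \<Rightarrow> 'a" assume "g \<in> ?F"
  then obtain f where f: "f \<in> smooth_functions V" "\<And>z. z \<in> V \<Longrightarrow> f z = g z" by blast
  show "continuous_on V g" by (rule continuous_on_eq[OF smooth_continuous[OF f(1)] f(2)])
  fix v :: complex assume v: "v \<in> {1, \<i>}"
  have "has_pd g v (partial_deriv v f z) z" if "z \<in> V" for z
    by (rule has_pd_transform[OF smooth_has_pd[OF f(1) v that] \<open>open V\<close> that f(2)])
  then show "\<exists>g'\<in>?F. \<forall>z\<in>V. has_pd g v (g' z) z"
    using smooth_partial_deriv[OF f(1) v] by blast
qed

lemma smooth_linear: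
  assumes "open V" "bounded_linear T" "f \<in> smooth_functions V"
  shows "(\<lambda>z. T (f z)) \<in> smooth_functions V"
proof (rule smooth_functions_coinduct[OF \<open>open V\<close>])
  let ?F = "(\<lambda>f z. T (f z)) ` smooth_functions V"
  show "(\<lambda>z. T (f z)) \<in> ?F" by (rule imageI[OF assms(3)])
  fix g assume "g \<in> ?F"
  then obtain f where g: "g = (\<lambda>z. T (f z))" and f: "f \<in> smooth_functions V" by auto
  show "continuous_on V g"
    unfolding g by (rule bounded_linear.continuous_on[OF assms(2) smooth_continuous[OF f]])
  fix v :: complex assume v: "v \<in> {1, \<i>}"
  show "\<exists>g'\<in>?F. \<forall>z\<in>V. has_pd g v (g' z) z"
  proof (intro bexI ballI)
    show "has_pd g v (T (partial_deriv v f z)) z" if "z \<in> V" for z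
      unfolding g by (rule has_pd_linear[OF assms(2) smooth_has_pd[OF f v that]])
    show "(\<lambda>z. T (partial_deriv v f z)) \<in> ?F"
      by (rule imageI[OF smooth_partial_deriv[OF f v]])
  qed
qed

lemma smooth_add:
  assumes "open V" "f \<in> smooth_functions V" "g \<in> smooth_functions V"
  shows "(\<lambda>z. f z + g z) \<in> smooth_functions V"
proof (rule smooth_functions_coinduct[OF \<open>open V\<close>])
  let ?F = "{\<lambda>z. f z + g z | f g. f \<in> smooth_functions V \<and> g \<in> smooth_functions V}"
  show "(\<lambda>z. f z + g z) \<in> ?F" using assms(2,3) by blast
  fix h assume "h \<in> ?F"
  then obtain f g where h: "h = (\<lambda>z. f z + g z)"
    and f: "f \<in> smooth_functions V" and g: "g \<in> smooth_functions V" by auto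
  show "continuous_on V h"
    unfolding h by (intro continuous_on_add smooth_continuous f g)
  fix v :: complex assume v: "v \<in> {1, \<i>}"
  show "\<exists>h'\<in>?F. \<forall>z\<in>V. has_pd h v (h' z) z"
  proof (intro bexI ballI)
    show "has_pd h v (partial_deriv v f z + partial_deriv v g z) z" if "z \<in> V" for z
      unfolding h by (rule has_pd_add[OF smooth_has_pd[OF f v that] smooth_has_pd[OF g v that]])
    show "(\<lambda>z. partial_deriv v f z + partial_deriv v g z) \<in> ?F"
      using smooth_partial_deriv[OF f v] smooth_partial_deriv[OF g v] by blast
  qed
qed

lemma continuous_on_scaleC:
  fixes f :: "complex \<Rightarrow> 'a::complex_normed_vector"
  shows "continuous_on V f \<Longrightarrow> continuous_on V (\<lambda>z. z *\<^sub>C f z)"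
  by (intro bounded_bilinear.continuous_on[OF bounded_bilinear_scaleC] continuous_on_id)

text \<open>The functions \<open>z f z\<close> alone are not closed under differentiation; the family
  \<open>z f z + g z\<close> is.\<close>

lemma smooth_mult:
  fixes f :: "complex \<Rightarrow> 'a::complex_normed_vector"
  assumes "open V" "f \<in> smooth_functions V"
  shows "(\<lambda>z. z *\<^sub>C f z) \<in> smooth_functions V"
proof -
  let ?F = "{\<lambda>z. z *\<^sub>C f z + g z | (f :: complex \<Rightarrow> 'a) g.
    f \<in> smooth_functions V \<and> g \<in> smooth_functions V}"
  have "(\<lambda>z. z *\<^sub>C f z + 0 *\<^sub>R f z) \<in> smooth_functions V"
  proof (rule smooth_functions_coinduct[OF \<open>open V\<close>])
    show "(\<lambda>z. z *\<^sub>C f z + 0 *\<^sub>R f z) \<in> ?F"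
      using smooth_linear[OF assms(1) bounded_linear_scaleR_right assms(2), of 0] assms(2)
      by (intro CollectI exI[of _ f] exI[of _ "\<lambda>z. 0 *\<^sub>R f z"]) simp
    fix h assume "h \<in> ?F"
    then obtain f g where h: "h = (\<lambda>z. z *\<^sub>C f z + g z)"
      and f: "f \<in> smooth_functions V" and g: "g \<in> smooth_functions V"
      by auto
    show "continuous_on V h"
      unfolding h by (intro continuous_on_add continuous_on_scaleC smooth_continuous f g)
    fix v :: complex assume v: "v \<in> {1, \<i>}"
    let ?h' = "\<lambda>z. z *\<^sub>C partial_deriv v f z + (v *\<^sub>C f z + partial_deriv v g z)"
    have "(\<lambda>z. v *\<^sub>C f z + partial_deriv v g z) \<in> smooth_functions V"
      by (intro smooth_add smooth_linear[OF _ bounded_linear_scaleC] smooth_partial_deriv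
          assms(1) f g v)
    then have "?h' \<in> ?F"
      by (intro CollectI exI[of _ "partial_deriv v f"]
          exI[of _ "\<lambda>z. v *\<^sub>C f z + partial_deriv v g z"] conjI refl smooth_partial_deriv[OF f v])
    moreover have "has_pd h v (?h' z) z" if "z \<in> V" for z
      using has_pd_add[OF has_pd_mult[OF smooth_has_pd[OF f v that]] smooth_has_pd[OF g v that]]
      by (simp add: h ac_simps)
    ultimately show "\<exists>h'\<in>?F. \<forall>z\<in>V. has_pd h v (h' z) z"
      by (intro bexI[where x = ?h'] ballI)
  qed
  then show ?thesis by simp
qed

lemma partial_deriv_cong:
  assumes "open V" "z \<in> V" "f \<in> smooth_functions V" "\<And>w. w \<in> V \<Longrightarrow> f w = g w" "v \<in> {1, \<i>}"
  shows "partial_deriv v g z = partial_deriv v f z"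
  by (rule has_pd_imp(1)[OF has_pd_transform[OF smooth_has_pd[OF assms(3,5,2)] assms(1,2,4)]])

lemma partial_deriv_add:
  assumes "z \<in> V" "f \<in> smooth_functions V" "g \<in> smooth_functions V" "v \<in> {1, \<i>}"
  shows "partial_deriv v (\<lambda>z. f z + g z) z = partial_deriv v f z + partial_deriv v g z"
  by (rule has_pd_imp(1)[OF has_pd_add[OF smooth_has_pd[OF assms(2,4,1)]
          smooth_has_pd[OF assms(3,4,1)]]])

lemma partial_deriv_linear:
  assumes "z \<in> V" "f \<in> smooth_functions V" "bounded_linear T" "v \<in> {1, \<i>}"
  shows "partial_deriv v (\<lambda>z. T (f z)) z = T (partial_deriv v f z)"
  by (rule has_pd_imp(1)[OF has_pd_linear[OF assms(3) smooth_has_pd[OF assms(2,4,1)]]])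

lemma partial_deriv_mult:
  fixes f :: "complex \<Rightarrow> 'a::complex_normed_vector"
  assumes "z \<in> V" "f \<in> smooth_functions V" "v \<in> {1, \<i>}"
  shows "partial_deriv v (\<lambda>z. z *\<^sub>C f z) z = v *\<^sub>C f z + z *\<^sub>C partial_deriv v f z"
  by (rule has_pd_imp(1)[OF has_pd_mult[OF smooth_has_pd[OF assms(2,3,1)]]])

section \<open>Mean value estimates\<close>

text \<open>The mean value inequality, with the increment compared to a linear one.  It is the only tool
  from one-variable calculus behind the symmetry of mixed derivatives, the total differentiability
  and the radial estimate below.\<close>

lemma increment_bound:
  fixes g :: "real \<Rightarrow> 'a::real_normed_vector"
  assumes der: "\<And>s. s \<in> closed_segment 0 t \<Longrightarrow> (g has_vector_derivative g' s) (at s)"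
    and bound: "\<And>s. s \<in> closed_segment 0 t \<Longrightarrow> norm (g' s - L) \<le> e"
  shows "norm (g t - g 0 - t *\<^sub>R L) \<le> e * \<bar>t\<bar>"
proof -
  have "norm ((g t - t *\<^sub>R L) - (g 0 - 0 *\<^sub>R L)) \<le> e * norm (t - 0)"
  proof (rule differentiable_bound[where S = "closed_segment 0 t" and f = "\<lambda>s. g s - s *\<^sub>R L"
        and f' = "\<lambda>s h. h *\<^sub>R (g' s - L)"])
    fix s assume s: "s \<in> closed_segment 0 t"
    show "((\<lambda>s. g s - s *\<^sub>R L) has_derivative (\<lambda>h. h *\<^sub>R (g' s - L))) (at s within closed_segment 0 t)"
      using has_vector_derivative_diff[OF der[OF s]
          has_vector_derivative_scaleR[OF DERIV_ident has_vector_derivative_const[of L]]]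
      by - (rule has_derivative_at_withinI, simp add: has_vector_derivative_def)
    show "onorm (\<lambda>h. h *\<^sub>R (g' s - L)) \<le> e"
    proof (rule onorm_le)
      show "norm (h *\<^sub>R (g' s - L)) \<le> e * norm h" for h
        using mult_right_mono[OF bound[OF s] abs_ge_zero[of h]] by (simp add: mult.commute)
    qed
  qed auto
  moreover have "(g t - t *\<^sub>R L) - (g 0 - 0 *\<^sub>R L) = g t - g 0 - t *\<^sub>R L" by simp
  ultimately show ?thesis by (simp only: real_norm_def diff_0_right)
qed

text \<open>The mean value inequality in the direction \<open>w\<close> bounds the increments of the partial
  derivative along \<open>v\<close>; applied once more in the direction \<open>v\<close> it shows that the mixed second
  difference is close to \<open>h\<^sup>2\<close> times the mixed derivative.\<close>

lemma second_difference_bound: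
  assumes f: "f \<in> smooth_functions V" and v: "v \<in> {1, \<i>}" and w: "w \<in> {1, \<i>}"
    and "0 < h" "ball z (3 * h) \<subseteq> V"
    and bound: "\<And>y. y \<in> ball z (3 * h) \<Longrightarrow>
      norm (partial_deriv w (partial_deriv v f) y - L) \<le> e"
  shows "norm (f (z + of_real h * v + of_real h * w) - f (z + of_real h * v)
    - f (z + of_real h * w) + f z - (h * h) *\<^sub>R L) \<le> e * h * h"
proof -
  have mem: "z + of_real s * v + of_real t * w \<in> ball z (3 * h)"
    if "s \<in> closed_segment 0 h" "t \<in> closed_segment 0 h" for s t
  proof -
    have "norm (of_real s * v + of_real t * w) \<le> \<bar>s\<bar> * norm v + \<bar>t\<bar> * norm w"
      by (rule order.trans[OF norm_triangle_ineq]) (simp add: norm_mult)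
    also have "\<dots> < 3 * h" using that v w \<open>0 < h\<close> by (auto simp: closed_segment_eq_real_ivl)
    also have "norm (of_real s * v + of_real t * w) = dist (z + of_real s * v + of_real t * w) z"
      by (simp add: dist_norm)
    finally show ?thesis by (simp add: dist_commute)
  qed
  have mem': "z + of_real s * v + of_real t * w \<in> V"
    if "s \<in> closed_segment 0 h" "t \<in> closed_segment 0 h" for s t
    using mem[OF that] assms(5) by blast
  have inner: "norm (partial_deriv v f (z + of_real s * v + of_real h * w)
      - partial_deriv v f (z + of_real s * v) - h *\<^sub>R L) \<le> e * h" if s: "s \<in> closed_segment 0 h" for s
  proof -
    have "norm (partial_deriv v f (z + of_real s * v + of_real h * w)
      - partial_deriv v f (z + of_real s * v + of_real 0 * w) - h *\<^sub>R L) \<le> e * \<bar>h\<bar>"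
      by (rule increment_bound[where g = "\<lambda>t. partial_deriv v f (z + of_real s * v + of_real t * w)",
            OF has_pd_along_line[OF smooth_has_pd[OF smooth_partial_deriv[OF f v] w mem'[OF s]]]
               bound[OF mem[OF s]]])
    then show ?thesis using \<open>0 < h\<close> by simp
  qed
  let ?G = "\<lambda>s. f (z + of_real s * v + of_real h * w) - f (z + of_real s * v)"
  have "norm (?G h - ?G 0 - h *\<^sub>R (h *\<^sub>R L)) \<le> (e * h) * \<bar>h\<bar>"
  proof (rule increment_bound[OF _ inner])
    fix s assume s: "s \<in> closed_segment 0 h"
    have 1: "z + of_real h * w + of_real s * v \<in> V" "z + of_real s * v \<in> V"
      using mem'[OF s, of h] mem'[OF s, of 0] by (auto simp: algebra_simps)
    from has_vector_derivative_diff[OF has_pd_along_line[OF smooth_has_pd[OF f v 1(1)]]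
        has_pd_along_line[OF smooth_has_pd[OF f v 1(2)]]]
    show "(?G has_vector_derivative (partial_deriv v f (z + of_real s * v + of_real h * w)
      - partial_deriv v f (z + of_real s * v))) (at s)"
      by (simp add: algebra_simps)
  qed
  moreover have "?G h - ?G 0 - h *\<^sub>R (h *\<^sub>R L) = f (z + of_real h * v + of_real h * w)
      - f (z + of_real h * v) - f (z + of_real h * w) + f z - (h * h) *\<^sub>R L"
    by (simp only: of_real_0 mult_zero_left add_0_right scaleR_scaleR diff_diff_eq2 diff_add_eq)
  ultimately show ?thesis by (simp only: abs_of_pos[OF \<open>0 < h\<close>])
qed

text \<open>Schwarz's theorem: the mixed second difference is symmetric in the two directions, so by the
  preceding estimate both mixed derivatives are the limit of the same quotients.\<close>

lemma partial_deriv_commute: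
  assumes f: "f \<in> smooth_functions V" and "open V" "z \<in> V"
    and v: "v \<in> {1, \<i>}" and w: "w \<in> {1, \<i>}"
  shows "partial_deriv v (partial_deriv w f) z = partial_deriv w (partial_deriv v f) z"
proof -
  let ?L = "partial_deriv w (partial_deriv v f) z"
  let ?M = "partial_deriv v (partial_deriv w f) z"
  have near: "\<forall>\<^sub>F y in nhds z. norm (partial_deriv a (partial_deriv b f) y
      - partial_deriv a (partial_deriv b f) z) < e"
    if "a \<in> {1, \<i>}" "b \<in> {1, \<i>}" "e > 0" for a b e
  proof -
    have "isCont (partial_deriv a (partial_deriv b f)) z"
      using smooth_continuous[OF smooth_partial_deriv[OF smooth_partial_deriv[OF f that(2)] that(1)]]
        assms(2,3) continuous_on_eq_continuous_at by blast
    from tendstoD[OF this[unfolded isCont_def] \<open>e > 0\<close>] show ?thesis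
      using \<open>e > 0\<close> by (simp add: eventually_nhds_conv_at dist_norm)
  qed
  have "norm (?L - ?M) \<le> 2 * e" if "e > 0" for e
  proof -
    have "\<forall>\<^sub>F y in nhds z. y \<in> V \<and>
        norm (partial_deriv w (partial_deriv v f) y - ?L) < e \<and>
        norm (partial_deriv v (partial_deriv w f) y - ?M) < e"
      using near[OF w v that] near[OF v w that] eventually_nhds_in_open[OF assms(2,3)]
      by eventually_elim simp
    then obtain d where d: "d > 0" "\<And>y. dist y z < d \<Longrightarrow> y \<in> V \<and>
        norm (partial_deriv w (partial_deriv v f) y - ?L) < e \<and>
        norm (partial_deriv v (partial_deriv w f) y - ?M) < e"
      unfolding eventually_nhds_metric by blast
    \<comment> \<open>A third of the radius: the corner of the square and the bound for its distance from \<open>z\<close>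
      then stay inside the ball of radius \<open>3 * h = d\<close>.\<close>
    define h where "h = d / 3"
    have h: "0 < h" using d(1) by (simp add: h_def)
    have ball: "ball z (3 * h) \<subseteq> V" using d(2) by (auto simp: h_def dist_commute)
    let ?D = "f (z + of_real h * v + of_real h * w) - f (z + of_real h * v)
        - f (z + of_real h * w) + f z"
    have L: "norm (?D - (h * h) *\<^sub>R ?L) \<le> e * h * h"
      by (rule second_difference_bound[OF f v w h ball])
        (use d(2) in \<open>force simp: h_def dist_commute\<close>)
    have "norm (f (z + of_real h * w + of_real h * v) - f (z + of_real h * w)
        - f (z + of_real h * v) + f z - (h * h) *\<^sub>R ?M) \<le> e * h * h"
      by (rule second_difference_bound[OF f w v h ball])
        (use d(2) in \<open>force simp: h_def dist_commute\<close>)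
    moreover have "f (z + of_real h * w + of_real h * v) - f (z + of_real h * w)
        - f (z + of_real h * v) + f z = ?D"
      by (simp add: add.assoc add.commute[of "of_real h * w"] cancel_ab_semigroup_add_class.diff_right_commute)
    ultimately have M: "norm (?D - (h * h) *\<^sub>R ?M) \<le> e * h * h"
      by (simp only:)
    have "norm ((?D - (h * h) *\<^sub>R ?M) - (?D - (h * h) *\<^sub>R ?L)) \<le> e * h * h + e * h * h"
      by (intro norm_triangle_le_diff add_mono L M)
    also have "(?D - (h * h) *\<^sub>R ?M) - (?D - (h * h) *\<^sub>R ?L) = (h * h) *\<^sub>R (?L - ?M)"
      by (simp only: scaleR_diff_right) simp
    finally have "(h * h) * norm (?L - ?M) \<le> (h * h) * (2 * e)" using h by simp
    then show ?thesis using h by (simp only: mult_le_cancel_left_pos mult_pos_pos)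
  qed
  from this[of "norm (?L - ?M) / 4"] have "norm (?L - ?M) \<le> 0"
    by (cases "norm (?L - ?M) > 0") auto
  then show ?thesis by simp
qed

lemma norm_diff_chain:
  fixes p q r s t :: "'a::real_normed_vector"
  assumes "norm (p - q - r) \<le> c" "norm (s - p - t) \<le> d"
  shows "norm (s - q - (r + t)) \<le> c + d"
proof -
  have "s - q - (r + t) = (p - q - r) + (s - p - t)" by simp
  then show ?thesis using norm_triangle_mono[OF assms] by metis
qed

text \<open>Continuous partial derivatives yield a total derivative: an increment is split into a
  horizontal and a vertical segment.\<close>

lemma smooth_has_derivative:
  assumes f: "f \<in> smooth_functions V" and "open V" "z \<in> V"
  shows "(f has_derivative (\<lambda>h. Re h *\<^sub>R partial_deriv 1 f z + Im h *\<^sub>R partial_deriv \<i> f z)) (at z)"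
  unfolding has_derivative_at_alt
proof (intro conjI allI impI)
  show "bounded_linear (\<lambda>h. Re h *\<^sub>R partial_deriv 1 f z + Im h *\<^sub>R partial_deriv \<i> f z)"
    by (rule bounded_linear_add[OF bounded_linear_scaleR_const[OF bounded_linear_Re] bounded_linear_scaleR_const[OF bounded_linear_Im]])
  fix e :: real assume "e > 0"
  have near: "\<forall>\<^sub>F y in nhds z. norm (partial_deriv v f y - partial_deriv v f z) < e / 2"
    if "v \<in> {1, \<i>}" for v
  proof -
    have "isCont (partial_deriv v f) z"
      using smooth_continuous[OF smooth_partial_deriv[OF f that]] assms(2,3)
        continuous_on_eq_continuous_at by blast
    from tendstoD[OF this[unfolded isCont_def], of "e / 2"] show ?thesis
      using \<open>e > 0\<close> by (auto simp: eventually_nhds_conv_at dist_norm)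
  qed
  have "\<forall>\<^sub>F y in nhds z. y \<in> V \<and> norm (partial_deriv 1 f y - partial_deriv 1 f z) < e / 2 \<and>
      norm (partial_deriv \<i> f y - partial_deriv \<i> f z) < e / 2"
    using near[of 1] near[of \<i>] eventually_nhds_in_open[OF assms(2,3)] by (simp add: eventually_conj)
  then obtain d where d: "d > 0" "\<And>y. dist y z < d \<Longrightarrow> y \<in> V \<and>
      norm (partial_deriv 1 f y - partial_deriv 1 f z) < e / 2 \<and>
      norm (partial_deriv \<i> f y - partial_deriv \<i> f z) < e / 2"
    unfolding eventually_nhds_metric by blast
  show "\<exists>d>0. \<forall>y. norm (y - z) < d \<longrightarrow> norm (f y - f z -
      (Re (y - z) *\<^sub>R partial_deriv 1 f z + Im (y - z) *\<^sub>R partial_deriv \<i> f z)) \<le> e * norm (y - z)"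
  proof (intro exI conjI allI impI)
    fix y assume y: "norm (y - z) < d"
    define a where "a = Re (y - z)"
    define b where "b = Im (y - z)"
    define c where "c = z + of_real a"
    have y_eq: "c + of_real b * \<i> = y"
      by (simp add: a_def b_def c_def complex_eq_iff)
    have horiz: "dist (z + of_real s * 1) z < d" if "s \<in> closed_segment 0 a" for s
    proof -
      have "\<bar>s\<bar> \<le> \<bar>a\<bar>" using that by (auto simp: closed_segment_eq_real_ivl split: if_splits)
      also have "\<dots> \<le> norm (y - z)" unfolding a_def by (rule abs_Re_le_cmod)
      finally show ?thesis using y by (simp add: dist_norm)
    qed
    have vert: "dist (c + of_real s * \<i>) z < d" if "s \<in> closed_segment 0 b" for s
    proof -
      have "\<bar>s\<bar> \<le> \<bar>b\<bar>" using that by (auto simp: closed_segment_eq_real_ivl split: if_splits)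
      then have "a\<^sup>2 + s\<^sup>2 \<le> a\<^sup>2 + b\<^sup>2" by (simp add: abs_le_square_iff)
      then have "norm (Complex a s) \<le> norm (Complex a b)" by (simp add: complex_norm)
      moreover have "c + of_real s * \<i> - z = Complex a s" "Complex a b = y - z"
        by (simp_all add: complex_eq_iff c_def a_def b_def)
      ultimately show ?thesis using y by (simp only: dist_norm)
    qed
    have "norm (f (z + of_real a * 1) - f (z + of_real 0 * 1) - a *\<^sub>R partial_deriv 1 f z)
        \<le> e / 2 * \<bar>a\<bar>"
      by (rule increment_bound[OF has_pd_along_line[OF smooth_has_pd[OF f]]])
        (use d(2)[OF horiz] in \<open>auto intro: less_imp_le\<close>)
    then have 1: "norm (f c - f z - a *\<^sub>R partial_deriv 1 f z) \<le> e / 2 * \<bar>a\<bar>"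
      unfolding c_def by simp
    have "norm (f (c + of_real b * \<i>) - f (c + of_real 0 * \<i>) - b *\<^sub>R partial_deriv \<i> f z)
        \<le> e / 2 * \<bar>b\<bar>"
      by (rule increment_bound[OF has_pd_along_line[OF smooth_has_pd[OF f]]])
        (use d(2)[OF vert] in \<open>auto intro: less_imp_le\<close>)
    then have 2: "norm (f y - f c - b *\<^sub>R partial_deriv \<i> f z) \<le> e / 2 * \<bar>b\<bar>"
      unfolding y_eq by simp
    have "norm (f y - f z - (a *\<^sub>R partial_deriv 1 f z + b *\<^sub>R partial_deriv \<i> f z))
        \<le> e / 2 * \<bar>a\<bar> + e / 2 * \<bar>b\<bar>"
      by (rule norm_diff_chain[OF 1 2])
    also have "\<dots> \<le> e * norm (y - z)"
      using mult_left_mono[OF abs_Re_le_cmod[of "y - z", folded a_def], of "e / 2"]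
        mult_left_mono[OF abs_Im_le_cmod[of "y - z", folded b_def], of "e / 2"] \<open>e > 0\<close>
      by linarith
    finally show "norm (f y - f z - (Re (y - z) *\<^sub>R partial_deriv 1 f z
        + Im (y - z) *\<^sub>R partial_deriv \<i> f z)) \<le> e * norm (y - z)"
      unfolding a_def b_def .
  qed (rule d(1))
qed

text \<open>The terms in brackets form the Euler field applied to \<open>f\<close>.  The curve \<open>t ^ Suc a\<close> times
  \<open>f (t z)\<close> runs from \<open>0\<close> to \<open>f z\<close> on the unit interval, and its derivative is \<open>t ^ a\<close> times the
  expression assumed to be bounded.\<close>

lemma radial_bound:
  assumes f: "f \<in> smooth_functions V" and "open V" "cball 0 r \<subseteq> V" "z \<in> cball 0 r"
    and bound: "\<And>w. w \<in> cball 0 r \<Longrightarrow> norm (real (Suc a) *\<^sub>R f w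
      + (Re w *\<^sub>R partial_deriv 1 f w + Im w *\<^sub>R partial_deriv \<i> f w)) \<le> M"
  shows "norm (f z) \<le> M"
proof -
  let ?g = "\<lambda>t::real. t ^ Suc a *\<^sub>R f (of_real t * z)"
  let ?E = "\<lambda>w. real (Suc a) *\<^sub>R f w
      + (Re w *\<^sub>R partial_deriv 1 f w + Im w *\<^sub>R partial_deriv \<i> f w)"
  have "norm (?g 1 - ?g 0 - 1 *\<^sub>R 0) \<le> M * \<bar>1\<bar>"
  proof (rule increment_bound)
    fix s :: real assume s: "s \<in> closed_segment 0 1"
    then have s01: "0 \<le> s" "s \<le> 1" by (auto simp: closed_segment_eq_real_ivl)
    have sz: "of_real s * z \<in> cball 0 r"
      using s01 \<open>z \<in> cball 0 r\<close> mult_left_le_one_le[of "norm z" s] by (simp add: norm_mult)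
    let ?w = "of_real s * z"
    have curve: "((\<lambda>t. of_real t * z) has_derivative (\<lambda>h. of_real h * z)) (at s)"
      by (auto intro!: derivative_eq_intros)
    have "((\<lambda>t. f (of_real t * z)) has_derivative
        (\<lambda>h. Re (of_real h * z) *\<^sub>R partial_deriv 1 f ?w + Im (of_real h * z) *\<^sub>R partial_deriv \<i> f ?w)) (at s)"
      using has_derivative_compose[OF curve smooth_has_derivative[OF f \<open>open V\<close>]] sz assms(3) by auto
    then have "((\<lambda>t. f (of_real t * z)) has_vector_derivative
        (Re z *\<^sub>R partial_deriv 1 f ?w + Im z *\<^sub>R partial_deriv \<i> f ?w)) (at s)"
      by (simp add: has_vector_derivative_def algebra_simps)
    moreover have "((\<lambda>t::real. t ^ Suc a) has_real_derivative (real (Suc a) * s ^ a)) (at s)"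
      using DERIV_pow[of "Suc a" s] by simp
    ultimately have "(?g has_vector_derivative (s ^ Suc a *\<^sub>R
        (Re z *\<^sub>R partial_deriv 1 f ?w + Im z *\<^sub>R partial_deriv \<i> f ?w)
        + (real (Suc a) * s ^ a) *\<^sub>R f ?w)) (at s)"
      by (intro has_vector_derivative_scaleR)
    then show "(?g has_vector_derivative (s ^ a *\<^sub>R ?E ?w)) (at s)"
      by (simp add: algebra_simps)
    have "norm (s ^ a *\<^sub>R ?E ?w) \<le> 1 * M"
      unfolding norm_scaleR using s01 by (intro mult_mono bound sz) (auto simp: power_le_one)
    then show "norm (s ^ a *\<^sub>R ?E ?w - 0) \<le> M" by simp
  qed
  then show ?thesis by simp
qed

section \<open>Wirtinger derivatives\<close>

text \<open>Both Wirtinger derivatives have the same shape up to the sign of \<open>\<i>\<close>; the parameter \<open>c\<close> lets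
  them share their calculus.  The choice \<open>c = - \<i>\<close> is the derivative with respect to \<open>z\<close>, the
  choice \<open>c = \<i>\<close> the one with respect to the conjugate.\<close>

definition wirtinger ::
    "complex \<Rightarrow> (complex \<Rightarrow> 'a::complex_normed_vector) \<Rightarrow> complex \<Rightarrow> 'a"
  where "wirtinger c f z = (1 / 2) *\<^sub>C (partial_deriv 1 f z + c *\<^sub>C partial_deriv \<i> f z)"

abbreviation "wirt \<equiv> wirtinger (- \<i>)"
abbreviation "wirt_bar \<equiv> wirtinger \<i>"

lemma smooth_wirtinger:
  assumes "open V" "f \<in> smooth_functions V"
  shows "wirtinger c f \<in> smooth_functions V"
  unfolding wirtinger_def
  by (intro smooth_linear[OF assms(1) bounded_linear_scaleC] smooth_add[OF assms(1)]
      smooth_partial_deriv[OF assms(2)]) auto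

lemma smooth_wirtinger_pow:
  assumes "open V" "f \<in> smooth_functions V"
  shows "(wirtinger c ^^ a) f \<in> smooth_functions V"
  by (induction a) (simp_all add: assms smooth_wirtinger)

lemma wirtinger_cong:
  assumes "open V" "z \<in> V" "f \<in> smooth_functions V" "\<And>w. w \<in> V \<Longrightarrow> f w = g w"
  shows "wirtinger c g z = wirtinger c f z"
  unfolding wirtinger_def using partial_deriv_cong[OF assms, of 1] partial_deriv_cong[OF assms, of \<i>]
  by simp

lemma wirtinger_pow_cong:
  assumes "open V" "z \<in> V" "f \<in> smooth_functions V" "\<And>w. w \<in> V \<Longrightarrow> f w = g w"
  shows "(wirtinger c ^^ a) g z = (wirtinger c ^^ a) f z"
  using \<open>z \<in> V\<close>
proof (induction a arbitrary: z)
  case (Suc a)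
  then show ?case
    using wirtinger_cong[OF assms(1) Suc.prems smooth_wirtinger_pow[OF assms(1,3)],
        where g = "(wirtinger c ^^ a) g"] by simp
qed (simp add: assms)

lemma wirtinger_add:
  assumes "z \<in> V" "f \<in> smooth_functions V" "g \<in> smooth_functions V"
  shows "wirtinger c (\<lambda>z. f z + g z) z = wirtinger c f z + wirtinger c g z"
  using partial_deriv_add[OF assms]
  by (simp add: wirtinger_def scaleC_add_right ac_simps)

lemma wirtinger_scaleC:
  assumes "z \<in> V" "f \<in> smooth_functions V"
  shows "wirtinger c (\<lambda>z. k *\<^sub>C f z) z = k *\<^sub>C wirtinger c f z"
  using partial_deriv_linear[OF assms bounded_linear_scaleC[of k]]
  by (simp add: wirtinger_def scaleC_add_right scaleC_scaleC mult.commute)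

lemma wirtinger_mult:
  assumes "z \<in> V" "f \<in> smooth_functions V"
  shows "wirtinger c (\<lambda>z. z *\<^sub>C f z) z = ((1 + c * \<i>) / 2) *\<^sub>C f z + z *\<^sub>C wirtinger c f z"
proof -
  have "wirtinger c (\<lambda>z. z *\<^sub>C f z) z =
    (1 / 2) *\<^sub>C ((1 *\<^sub>C f z + z *\<^sub>C partial_deriv 1 f z)
      + c *\<^sub>C (\<i> *\<^sub>C f z + z *\<^sub>C partial_deriv \<i> f z))"
    using partial_deriv_mult[OF assms] by (simp add: wirtinger_def)
  also have "\<dots> = ((1 / 2) *\<^sub>C f z + (c * \<i> / 2) *\<^sub>C f z)
      + ((z / 2) *\<^sub>C partial_deriv 1 f z + (z * c / 2) *\<^sub>C partial_deriv \<i> f z)"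
    by (simp add: scaleC_add_right scaleC_scaleC mult.commute add.commute add.left_commute)
  also have "\<dots> = ((1 + c * \<i>) / 2) *\<^sub>C f z + z *\<^sub>C wirtinger c f z"
    by (simp add: wirtinger_def scaleC_add_right scaleC_scaleC scaleC_add_left[symmetric]
        add_divide_distrib)
  finally show ?thesis .
qed

lemma wirtinger_commute:
  assumes "open V" "z \<in> V" "f \<in> smooth_functions V"
  shows "wirtinger c (wirtinger d f) z = wirtinger d (wirtinger c f) z"
proof -
  have "wirtinger c (wirtinger d f) z = (1 / 2) *\<^sub>C (1 / 2) *\<^sub>C
      (partial_deriv 1 (partial_deriv 1 f) z + c *\<^sub>C partial_deriv \<i> (partial_deriv 1 f) z
        + d *\<^sub>C partial_deriv \<i> (partial_deriv 1 f) z
        + (c * d) *\<^sub>C partial_deriv \<i> (partial_deriv \<i> f) z)" for c d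
  proof -
    have x: "partial_deriv 1 f \<in> smooth_functions V" and y: "partial_deriv \<i> f \<in> smooth_functions V"
      by (auto intro: smooth_partial_deriv assms)
    have y': "(\<lambda>z. d *\<^sub>C partial_deriv \<i> f z) \<in> smooth_functions V"
      by (rule smooth_linear[OF assms(1) bounded_linear_scaleC y])
    have s: "(\<lambda>z. partial_deriv 1 f z + d *\<^sub>C partial_deriv \<i> f z) \<in> smooth_functions V"
      by (rule smooth_add[OF assms(1) x y'])
    have eq: "wirtinger d f = (\<lambda>z. (1 / 2) *\<^sub>C (partial_deriv 1 f z + d *\<^sub>C partial_deriv \<i> f z))"
      by (rule ext) (rule wirtinger_def)
    have "wirtinger c (wirtinger d f) z
      = (1 / 2) *\<^sub>C (wirtinger c (partial_deriv 1 f) z + d *\<^sub>C wirtinger c (partial_deriv \<i> f) z)"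
      unfolding eq wirtinger_scaleC[OF assms(2) s] wirtinger_add[OF assms(2) x y']
        wirtinger_scaleC[OF assms(2) y] ..
    also have "partial_deriv 1 (partial_deriv \<i> f) z = partial_deriv \<i> (partial_deriv 1 f) z"
      by (rule partial_deriv_commute[OF assms(3,1,2)]) auto
    then have "wirtinger c (partial_deriv \<i> f) z = (1 / 2) *\<^sub>C (partial_deriv \<i> (partial_deriv 1 f) z
        + c *\<^sub>C partial_deriv \<i> (partial_deriv \<i> f) z)"
      by (simp add: wirtinger_def)
    also have "wirtinger c (partial_deriv 1 f) z = (1 / 2) *\<^sub>C (partial_deriv 1 (partial_deriv 1 f) z
        + c *\<^sub>C partial_deriv \<i> (partial_deriv 1 f) z)"
      by (rule wirtinger_def)
    finally show ?thesis
      by (simp add: scaleC_add_right scaleC_scaleC mult.commute add.assoc)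
  qed
  from this[of c d] this[of d c] show ?thesis by (simp add: ac_simps)
qed

lemma wirtinger_pow_commute:
  assumes "open V" "z \<in> V" "f \<in> smooth_functions V"
  shows "(wirtinger c ^^ a) (wirtinger d f) z = wirtinger d ((wirtinger c ^^ a) f) z"
  using \<open>z \<in> V\<close>
proof (induction a arbitrary: z)
  case (Suc a)
  have "(wirtinger c ^^ Suc a) (wirtinger d f) z = wirtinger c ((wirtinger c ^^ a) (wirtinger d f)) z"
    by simp
  also have "\<dots> = wirtinger c (wirtinger d ((wirtinger c ^^ a) f)) z"
    by (rule wirtinger_cong[OF assms(1) Suc.prems])
      (simp_all add: Suc.IH smooth_wirtinger smooth_wirtinger_pow assms)
  also have "\<dots> = wirtinger d (wirtinger c ((wirtinger c ^^ a) f)) z"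
    by (rule wirtinger_commute[OF assms(1) Suc.prems smooth_wirtinger_pow[OF assms(1,3)]])
  finally show ?case by simp
qed simp

text \<open>Leibniz' rule stops after two terms because \<open>z\<close> has derivative \<open>1\<close>.  For \<open>a = 0\<close> the
  truncated exponent \<open>a - 1\<close> is harmless, as its coefficient vanishes.\<close>

lemma wirt_pow_mult:
  assumes "open V" "z \<in> V" "f \<in> smooth_functions V"
  shows "(wirt ^^ a) (\<lambda>z. z *\<^sub>C f z) z = z *\<^sub>C (wirt ^^ a) f z + of_nat a *\<^sub>C (wirt ^^ (a - 1)) f z"
  using \<open>z \<in> V\<close>
proof (induction a arbitrary: z)
  case 0
  show ?case by (simp add: scaleC_zero_left)
next
  case (Suc a)
  let ?u = "(wirt ^^ a) f" and ?l = "(wirt ^^ (a - 1)) f"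
  have u: "?u \<in> smooth_functions V" and l: "?l \<in> smooth_functions V"
    by (simp_all add: smooth_wirtinger_pow assms)
  have zu: "(\<lambda>z. z *\<^sub>C ?u z) \<in> smooth_functions V" by (rule smooth_mult[OF assms(1) u])
  have al: "(\<lambda>z. of_nat a *\<^sub>C ?l z) \<in> smooth_functions V"
    by (rule smooth_linear[OF assms(1) bounded_linear_scaleC l])
  have "(wirt ^^ Suc a) (\<lambda>z. z *\<^sub>C f z) z = wirt (\<lambda>z. z *\<^sub>C ?u z + of_nat a *\<^sub>C ?l z) z"
    unfolding funpow.simps o_apply
    by (rule wirtinger_cong[OF assms(1) Suc.prems smooth_add[OF assms(1) zu al] Suc.IH[symmetric]])
  also have "\<dots> = (?u z + z *\<^sub>C wirt ?u z) + of_nat a *\<^sub>C wirt ?l z"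
    unfolding wirtinger_add[OF Suc.prems zu al] wirtinger_mult[OF Suc.prems u]
      wirtinger_scaleC[OF Suc.prems l] by (simp add: scaleC_one)
  also have "of_nat a *\<^sub>C wirt ?l z = of_nat a *\<^sub>C ?u z"
    by (cases a) (simp_all add: scaleC_zero_left)
  also have "(?u z + z *\<^sub>C wirt ?u z) + of_nat a *\<^sub>C ?u z
      = z *\<^sub>C wirt ?u z + (1 + of_nat a) *\<^sub>C ?u z"
    by (simp only: scaleC_add_left scaleC_one add.commute add.left_commute)
  finally show ?case by (simp only: of_nat_Suc funpow.simps o_apply diff_Suc_1)
qed

text \<open>The Euler field in complex coordinates.\<close>

lemma euler_wirtinger:
  "Re z *\<^sub>R partial_deriv 1 f z + Im z *\<^sub>R partial_deriv \<i> f z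
    = z *\<^sub>C wirt f z + cnj z *\<^sub>C wirt_bar f z"
proof -
  let ?x = "partial_deriv 1 f z" and ?y = "partial_deriv \<i> f z"
  have "z *\<^sub>C wirt f z + cnj z *\<^sub>C wirt_bar f z
    = ((z / 2) *\<^sub>C ?x + (- (z * \<i> / 2)) *\<^sub>C ?y) + ((cnj z / 2) *\<^sub>C ?x + (cnj z * \<i> / 2) *\<^sub>C ?y)"
    by (simp add: wirtinger_def scaleC_add_right scaleC_scaleC)
  also have "\<dots> = (z / 2 + cnj z / 2) *\<^sub>C ?x + (- (z * \<i> / 2) + cnj z * \<i> / 2) *\<^sub>C ?y"
    by (simp only: scaleC_add_left ac_simps)
  also have "z / 2 + cnj z / 2 = of_real (Re z)" by (simp add: complex_eq_iff)
  also have "- (z * \<i> / 2) + cnj z * \<i> / 2 = of_real (Im z)" by (simp add: complex_eq_iff)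
  finally show ?thesis by (simp only: scaleC_of_real)
qed

section \<open>Null sequences\<close>

text \<open>Convergence in the Frechet space of smooth functions is locally uniform convergence of all
  iterated partial derivatives, and only the limit \<open>0\<close> occurs here.\<close>

definition null_on :: "complex set \<Rightarrow> (nat \<Rightarrow> complex \<Rightarrow> 'a::real_normed_vector) \<Rightarrow> bool"
  where "null_on V f \<longleftrightarrow>
    (\<forall>K. compact K \<and> K \<subseteq> V \<longrightarrow> uniform_limit K f (\<lambda>_. 0) sequentially)"

lemma null_on_cong:
  assumes "null_on V f" "\<And>n z. z \<in> V \<Longrightarrow> f n z = g n z"
  shows "null_on V g"
  unfolding null_on_def
proof (intro allI impI)
  fix K assume K: "compact K \<and> K \<subseteq> V"
  then have "uniform_limit K f (\<lambda>_. 0) sequentially" using assms(1) by (simp add: null_on_def)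
  moreover have "uniform_limit K f (\<lambda>_. 0) sequentially = uniform_limit K g (\<lambda>_. 0) sequentially"
    by (rule uniform_limit_cong') (use K assms(2) in auto)
  ultimately show "uniform_limit K g (\<lambda>_. 0) sequentially" by simp
qed

lemma null_on_add:
  assumes "null_on V f" "null_on V g"
  shows "null_on V (\<lambda>n z. f n z + g n z)"
  unfolding null_on_def
proof (intro allI impI)
  fix K assume "compact K \<and> K \<subseteq> V"
  then have "uniform_limit K f (\<lambda>_. 0) sequentially" "uniform_limit K g (\<lambda>_. 0) sequentially"
    using assms by (simp_all add: null_on_def)
  from uniform_limit_add[OF this]
  show "uniform_limit K (\<lambda>n z. f n z + g n z) (\<lambda>_. 0) sequentially" by simp
qed

lemma null_on_linear:
  assumes "null_on V f" "bounded_linear T"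
  shows "null_on V (\<lambda>n z. T (f n z))"
  unfolding null_on_def
proof (intro allI impI)
  fix K assume "compact K \<and> K \<subseteq> V"
  then have "uniform_limit K f (\<lambda>_. 0) sequentially" using assms(1) by (simp add: null_on_def)
  from bounded_linear.uniform_limit[OF assms(2) this]
  show "uniform_limit K (\<lambda>n z. T (f n z)) (\<lambda>_. 0) sequentially"
    by (simp add: linear_simps(3)[OF assms(2)])
qed

lemma null_on_norm_eq:
  assumes "null_on V f" "\<And>n z. z \<in> V \<Longrightarrow> norm (g n z) = norm (f n z)"
  shows "null_on V g"
  unfolding null_on_def
proof (intro allI impI)
  fix K assume K: "compact K \<and> K \<subseteq> V"
  then have "uniform_limit K f (\<lambda>_. 0) sequentially" using assms(1) by (simp add: null_on_def)
  then show "uniform_limit K g (\<lambda>_. 0) sequentially"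
    by (rule metric_uniform_limit_imp_uniform_limit) (use K assms(2) in \<open>auto intro!: always_eventually\<close>)
qed

text \<open>Smoothness of the terms is made part of the notion, so that null sequences admit a
  coinduction principle like the one for smooth functions.\<close>

definition null_smooth :: "complex set \<Rightarrow> (nat \<Rightarrow> complex \<Rightarrow> 'a::real_normed_vector) \<Rightarrow> bool"
  where "null_smooth V f \<longleftrightarrow> (\<forall>n. f n \<in> smooth_functions V) \<and>
    (\<forall>vs \<in> lists {1, \<i>}. null_on V (\<lambda>n. partial_derivs vs (f n)))"

lemma partial_derivs_zero: "partial_derivs vs (\<lambda>_. 0) = (\<lambda>_. 0)"
  by (induction vs) (auto simp: partial_deriv_def fun_eq_iff)

lemma null_smooth_iff:
  "null_smooth V f \<longleftrightarrow> (\<forall>n. f n \<in> smooth_functions V) \<and> smooth_tendsto V f (\<lambda>_. 0)"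
  unfolding null_smooth_def smooth_tendsto_def null_on_def partial_derivs_zero by blast

lemma null_smoothD:
  assumes "null_smooth V f"
  shows "f n \<in> smooth_functions V" "null_on V f"
proof -
  have "null_on V (\<lambda>n. partial_derivs [] (f n))"
    using assms unfolding null_smooth_def by blast
  then show "null_on V f" by simp
  show "f n \<in> smooth_functions V" using assms unfolding null_smooth_def by blast
qed

lemma null_smooth_partial_deriv:
  assumes "null_smooth V f" "v \<in> {1, \<i>}"
  shows "null_smooth V (\<lambda>n. partial_deriv v (f n))"
  unfolding null_smooth_def
proof (intro conjI allI ballI)
  show "partial_deriv v (f n) \<in> smooth_functions V" for n
    by (rule smooth_partial_deriv[OF null_smoothD(1)[OF assms(1)] assms(2)])
  fix vs assume "vs \<in> lists {1, \<i>}"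
  then have "vs @ [v] \<in> lists {1, \<i>}" using assms(2) by simp
  then have "null_on V (\<lambda>n. partial_derivs (vs @ [v]) (f n))"
    using assms(1) unfolding null_smooth_def by blast
  then show "null_on V (\<lambda>n. partial_derivs vs (partial_deriv v (f n)))"
    by (simp add: partial_derivs_append)
qed

lemma null_smooth_coinduct:
  assumes "open V" "f \<in> F"
    and smooth: "\<And>g n. g \<in> F \<Longrightarrow> g n \<in> smooth_functions V"
    and null: "\<And>g. g \<in> F \<Longrightarrow> null_on V g"
    and step: "\<And>g v. g \<in> F \<Longrightarrow> v \<in> {1, \<i>} \<Longrightarrow>
      \<exists>g'\<in>F. \<forall>n. \<forall>z\<in>V. partial_deriv v (g n) z = g' n z"
  shows "null_smooth V f"
proof -
  have derivs: "\<exists>g'\<in>F. \<forall>n. \<forall>z\<in>V. partial_derivs vs (f n) z = g' n z"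
    if "vs \<in> lists {1, \<i>}" for vs
    using that
  proof (induction vs)
    case Nil
    show ?case by (rule bexI[OF _ \<open>f \<in> F\<close>]) simp
  next
    case (Cons v vs)
    then obtain g where g: "g \<in> F" "\<And>n z. z \<in> V \<Longrightarrow> partial_derivs vs (f n) z = g n z" by auto
    obtain g' where g': "g' \<in> F" "\<And>n z. z \<in> V \<Longrightarrow> partial_deriv v (g n) z = g' n z"
      using step[OF g(1), of v] Cons.hyps by blast
    have "partial_deriv v (partial_derivs vs (f n)) z = g' n z" if "z \<in> V" for n z
      using partial_deriv_cong[OF \<open>open V\<close> that smooth[OF g(1)] g(2)[symmetric] Cons.hyps(1)]
        g'(2)[OF that] by metis
    then show ?case by (intro bexI[OF _ g'(1)]) simp
  qed
  show ?thesis
    unfolding null_smooth_def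
  proof (intro conjI allI ballI)
    show "f n \<in> smooth_functions V" for n by (rule smooth[OF \<open>f \<in> F\<close>])
    fix vs assume "vs \<in> lists {1, \<i>}"
    from derivs[OF this] obtain g where g: "g \<in> F"
      "\<And>n z. z \<in> V \<Longrightarrow> partial_derivs vs (f n) z = g n z" by blast
    show "null_on V (\<lambda>n. partial_derivs vs (f n))"
      by (rule null_on_cong[OF null[OF g(1)] g(2)[symmetric]])
  qed
qed

lemma null_smooth_cong:
  assumes "open V" "null_smooth V f" "\<And>n z. z \<in> V \<Longrightarrow> f n z = g n z"
  shows "null_smooth V g"
proof (rule null_smooth_coinduct[OF \<open>open V\<close>])
  let ?F = "{g. \<exists>f. null_smooth V f \<and> (\<forall>n. \<forall>z\<in>V. f n z = g n z)}"
  show "g \<in> ?F" using assms(2,3) by blast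
  fix g :: "nat \<Rightarrow> complex \<Rightarrow> 'a" assume "g \<in> ?F"
  then obtain f where f: "null_smooth V f" "\<And>n z. z \<in> V \<Longrightarrow> f n z = g n z" by blast
  show "g n \<in> smooth_functions V" for n
    by (rule smooth_cong[OF assms(1) null_smoothD(1)[OF f(1)] f(2)])
  show "null_on V g" by (rule null_on_cong[OF null_smoothD(2)[OF f(1)] f(2)])
  fix v :: complex assume v: "v \<in> {1, \<i>}"
  have eq: "partial_deriv v (g n) z = partial_deriv v (f n) z" if "z \<in> V" for n z
    by (rule partial_deriv_cong[OF assms(1) that null_smoothD(1)[OF f(1)] f(2) v])
  show "\<exists>g'\<in>?F. \<forall>n. \<forall>z\<in>V. partial_deriv v (g n) z = g' n z"
  proof (intro bexI allI ballI)
    show "(\<lambda>n. partial_deriv v (f n)) \<in> ?F"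
      using null_smooth_partial_deriv[OF f(1) v] by blast
  qed (rule eq)
qed

lemma null_smooth_linear:
  assumes "open V" "null_smooth V f" "bounded_linear T"
  shows "null_smooth V (\<lambda>n z. T (f n z))"
proof (rule null_smooth_coinduct[OF \<open>open V\<close>])
  let ?F = "(\<lambda>f n z. T (f n z)) ` {f. null_smooth V f}"
  show "(\<lambda>n z. T (f n z)) \<in> ?F" by (rule imageI, rule CollectI, rule assms(2))
  fix g assume "g \<in> ?F"
  then obtain f where g: "g = (\<lambda>n z. T (f n z))" and f: "null_smooth V f" by blast
  show "g n \<in> smooth_functions V" for n
    unfolding g by (rule smooth_linear[OF assms(1,3) null_smoothD(1)[OF f]])
  show "null_on V g"
    unfolding g by (rule null_on_linear[OF null_smoothD(2)[OF f] assms(3)])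
  fix v :: complex assume v: "v \<in> {1, \<i>}"
  show "\<exists>g'\<in>?F. \<forall>n. \<forall>z\<in>V. partial_deriv v (g n) z = g' n z"
  proof (intro bexI allI ballI)
    show "(\<lambda>n z. T (partial_deriv v (f n) z)) \<in> ?F"
      by (rule imageI, rule CollectI, rule null_smooth_partial_deriv[OF f v])
    show "partial_deriv v (g n) z = T (partial_deriv v (f n) z)" if "z \<in> V" for n z
      unfolding g by (rule partial_deriv_linear[OF that null_smoothD(1)[OF f] assms(3) v])
  qed
qed

lemma null_smooth_add:
  assumes "open V" "null_smooth V f" "null_smooth V g"
  shows "null_smooth V (\<lambda>n z. f n z + g n z)"
proof (rule null_smooth_coinduct[OF \<open>open V\<close>])
  let ?F = "{\<lambda>n z. f n z + g n z | f g. null_smooth V f \<and> null_smooth V g}"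
  show "(\<lambda>n z. f n z + g n z) \<in> ?F" using assms(2,3) by blast
  fix h assume "h \<in> ?F"
  then obtain f g where h: "h = (\<lambda>n z. f n z + g n z)"
    and f: "null_smooth V f" and g: "null_smooth V g" by blast
  show "h n \<in> smooth_functions V" for n
    unfolding h by (rule smooth_add[OF assms(1) null_smoothD(1)[OF f] null_smoothD(1)[OF g]])
  show "null_on V h"
    unfolding h by (rule null_on_add[OF null_smoothD(2)[OF f] null_smoothD(2)[OF g]])
  fix v :: complex assume v: "v \<in> {1, \<i>}"
  show "\<exists>h'\<in>?F. \<forall>n. \<forall>z\<in>V. partial_deriv v (h n) z = h' n z"
  proof (intro bexI allI ballI)
    show "(\<lambda>n z. partial_deriv v (f n) z + partial_deriv v (g n) z) \<in> ?F"
      using null_smooth_partial_deriv[OF f v] null_smooth_partial_deriv[OF g v]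
      by (intro CollectI exI[of _ "\<lambda>n. partial_deriv v (f n)"]
          exI[of _ "\<lambda>n. partial_deriv v (g n)"] conjI refl)
    show "partial_deriv v (h n) z = partial_deriv v (f n) z + partial_deriv v (g n) z"
      if "z \<in> V" for n z
      unfolding h
      by (rule partial_deriv_add[OF that null_smoothD(1)[OF f] null_smoothD(1)[OF g] v])
  qed
qed

lemma null_smooth_wirtinger:
  assumes "open V" "null_smooth V f"
  shows "null_smooth V (\<lambda>n. wirtinger c (f n))"
proof -
  have x: "null_smooth V (\<lambda>n. partial_deriv 1 (f n))"
    and y: "null_smooth V (\<lambda>n. partial_deriv \<i> (f n))"
    by (rule null_smooth_partial_deriv[OF assms(2)], simp)+
  have "null_smooth V (\<lambda>n z. partial_deriv 1 (f n) z + c *\<^sub>C partial_deriv \<i> (f n) z)"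
    by (rule null_smooth_add[OF assms(1) x null_smooth_linear[OF assms(1) y bounded_linear_scaleC]])
  from null_smooth_linear[OF assms(1) this bounded_linear_scaleC]
  show ?thesis unfolding wirtinger_def[abs_def] .
qed

lemma null_smooth_wirtinger_pow:
  assumes "open V" "null_smooth V f"
  shows "null_smooth V (\<lambda>n. (wirtinger c ^^ a) (f n))"
  by (induction a) (simp_all add: assms null_smooth_wirtinger)

section \<open>Division by the coordinate function\<close>

text \<open>Near \<open>0\<close> the radial estimate bounds \<open>u\<close>; on the rest of a compact set \<open>\<bar>z\<bar>\<close> is bounded below,
  so that smallness of \<open>z u\<close> suffices.\<close>

lemma null_on_radial:
  fixes u :: "nat \<Rightarrow> complex \<Rightarrow> 'a::complex_normed_vector"
  assumes "open V" and smooth: "\<And>n. u n \<in> smooth_functions V"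
    and mult: "null_on V (\<lambda>n z. z *\<^sub>C u n z)"
    and radial: "null_on V (\<lambda>n z. real (Suc a) *\<^sub>R u n z
      + (Re z *\<^sub>R partial_deriv 1 (u n) z + Im z *\<^sub>R partial_deriv \<i> (u n) z))"
      (is "null_on V ?g")
  shows "null_on V u"
  unfolding null_on_def
proof (intro allI impI uniform_limitI)
  fix K and e :: real assume K: "compact K \<and> K \<subseteq> V" and "e > 0"
  \<comment> \<open>If \<open>0\<close> lies outside the open set, the compact set keeps a positive distance from it and
    the disc is not needed.\<close>
  have "\<exists>r>0. cball 0 r \<subseteq> V \<or> cball 0 r \<inter> K = {}"
  proof (cases "0 \<in> V")
    case True
    then show ?thesis using \<open>open V\<close> open_contains_cball by blast
  next
    case False
    then have "0 \<in> - K" "open (- K)" using K compact_imp_closed by (auto simp: open_Compl)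
    then obtain r where "r > 0" "cball 0 r \<subseteq> - K" using open_contains_cball by blast
    then show ?thesis by blast
  qed
  then obtain r where r: "r > 0" "cball 0 r \<subseteq> V \<or> cball 0 r \<inter> K = {}" by blast
  have "\<forall>\<^sub>F n in sequentially. \<forall>z\<in>K. norm (z *\<^sub>C u n z) < e * r"
  proof -
    have "uniform_limit K (\<lambda>n z. z *\<^sub>C u n z) (\<lambda>_. 0) sequentially"
      using mult K unfolding null_on_def by blast
    from uniform_limitD[OF this, of "e * r"] \<open>e > 0\<close> r(1) show ?thesis by simp
  qed
  moreover have "\<forall>\<^sub>F n in sequentially. cball 0 r \<subseteq> V \<longrightarrow> (\<forall>z\<in>cball 0 r. norm (?g n z) < e / 2)"
  proof (cases "cball 0 r \<subseteq> V")
    case True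
    then have "uniform_limit (cball 0 r) ?g (\<lambda>_. 0) sequentially"
      using radial compact_cball unfolding null_on_def by blast
    from uniform_limitD[OF this, of "e / 2"] \<open>e > 0\<close> show ?thesis by (simp add: dist_norm)
  qed simp
  ultimately show "\<forall>\<^sub>F n in sequentially. \<forall>z\<in>K. dist (u n z) 0 < e"
  proof eventually_elim
    case (elim n)
    show ?case
    proof
      fix z assume z: "z \<in> K"
      show "dist (u n z) 0 < e"
      proof (cases "z \<in> cball 0 r")
        case True
        then have V: "cball 0 r \<subseteq> V" using z r(2) by blast
        have "norm (u n z) \<le> e / 2"
        proof (rule radial_bound[OF smooth \<open>open V\<close> V True])
          show "norm (?g n w) \<le> e / 2" if "w \<in> cball 0 r" for w
            using elim(2) V that less_imp_le by blast
        qed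
        then show ?thesis using \<open>e > 0\<close> by simp
      next
        case False
        then have "r * norm (u n z) \<le> norm z * norm (u n z)" by (intro mult_right_mono) auto
        also have "\<dots> < e * r" using elim(1) z by (simp add: norm_scaleC)
        finally show ?thesis using r(1) by (simp add: mult.commute)
      qed
    qed
  qed
qed

text \<open>The coordinate \<open>z\<close> is holomorphic, hence a constant for the conjugate derivative.\<close>

lemma wirt_bar_mult:
  assumes "z \<in> V" "f \<in> smooth_functions V"
  shows "wirt_bar (\<lambda>z. z *\<^sub>C f z) z = z *\<^sub>C wirt_bar f z"
  unfolding wirtinger_mult[OF assms] by (simp add: scaleC_zero_left)

lemma null_smooth_mult_wirt_bar:
  assumes "open V" "\<And>n. f n \<in> smooth_functions V" "null_smooth V (\<lambda>n z. z *\<^sub>C f n z)"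
  shows "null_smooth V (\<lambda>n z. z *\<^sub>C wirt_bar (f n) z)"
  by (rule null_smooth_cong[OF assms(1) null_smooth_wirtinger[OF assms(1,3)]])
    (rule wirt_bar_mult[OF _ assms(2)])

lemma null_on_minus:
  assumes "null_on V f" "null_on V g"
  shows "null_on V (\<lambda>n z. f n z - g n z)"
  using null_on_add[OF assms(1) null_on_linear[OF assms(2) bounded_linear_minus[OF bounded_linear_ident]]]
  by simp

text \<open>The induction runs over all sequences at once: the bound for \<open>a\<close> derivatives of \<open>f\<close> uses the
  one for \<open>a - 1\<close> derivatives both of \<open>f\<close> and of its conjugate derivative, and the latter satisfies
  the same hypothesis.\<close>

lemma null_on_wirt_pow:
  fixes f :: "nat \<Rightarrow> complex \<Rightarrow> 'a::complex_normed_vector"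
  assumes "open V" "\<And>n. f n \<in> smooth_functions V" "null_smooth V (\<lambda>n z. z *\<^sub>C f n z)"
  shows "null_on V (\<lambda>n. (wirt ^^ a) (f n))"
  using assms(2,3)
proof (induction a arbitrary: f rule: less_induct)
  case (less a)
  have mult: "null_on V (\<lambda>n z. z *\<^sub>C (wirt ^^ a) (f n) z)"
    if f: "\<And>n. f n \<in> smooth_functions V" and zf: "null_smooth V (\<lambda>n z. z *\<^sub>C f n z)"
    for f :: "nat \<Rightarrow> complex \<Rightarrow> 'a"
  proof -
    have "null_on V (\<lambda>n z. of_nat a *\<^sub>C (wirt ^^ (a - 1)) (f n) z)"
    proof (cases a)
      case 0
      then show ?thesis
        by (simp add: scaleC_zero_left null_on_def
            uniform_limit_iff)
    next
      case (Suc b)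
      have "null_on V (\<lambda>n. (wirt ^^ b) (f n))"
        by (rule less.IH[OF _ f zf]) (simp add: Suc)
      from null_on_linear[OF this bounded_linear_scaleC[of "of_nat a"]] show ?thesis
        by (simp only: Suc diff_Suc_1)
    qed
    from null_on_minus[OF null_smoothD(2)[OF null_smooth_wirtinger_pow[OF assms(1) zf, of a "- \<i>"]] this]
    show ?thesis
      by (rule null_on_cong) (simp only: wirt_pow_mult[OF assms(1) _ f] add_diff_cancel_right')
  qed
  have bar: "null_on V (\<lambda>n z. z *\<^sub>C (wirt ^^ a) (wirt_bar (f n)) z)"
    by (rule mult[OF smooth_wirtinger[OF assms(1) less.prems(1)]
          null_smooth_mult_wirt_bar[OF assms(1) less.prems]])
  let ?u = "\<lambda>n. (wirt ^^ a) (f n)"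
  have u: "?u n \<in> smooth_functions V" for n
    by (rule smooth_wirtinger_pow[OF assms(1) less.prems(1)])
  have "null_on V (\<lambda>n z. cnj z *\<^sub>C wirt_bar (?u n) z)"
    \<comment> \<open>The factors \<open>z\<close> and \<open>cnj z\<close> have the same modulus, and this is all that matters.\<close>
    by (rule null_on_norm_eq[OF bar])
      (simp add: norm_scaleC wirtinger_pow_commute[OF assms(1) _ less.prems(1)])
  from null_on_add[OF null_smoothD(2)[OF null_smooth_wirtinger_pow[OF assms(1) less.prems(2), of "Suc a" "- \<i>"]] this]
  have radial: "null_on V (\<lambda>n z. real (Suc a) *\<^sub>R ?u n z
      + (Re z *\<^sub>R partial_deriv 1 (?u n) z + Im z *\<^sub>R partial_deriv \<i> (?u n) z))"
  proof (rule null_on_cong)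
    fix n z assume "z \<in> V"
    have "(wirt ^^ Suc a) (\<lambda>z. z *\<^sub>C f n z) z = z *\<^sub>C wirt (?u n) z + real (Suc a) *\<^sub>R ?u n z"
      unfolding wirt_pow_mult[OF assms(1) \<open>z \<in> V\<close> less.prems(1)]
      by (simp only: scaleC_of_real[symmetric] of_real_of_nat_eq funpow.simps o_apply diff_Suc_1)
    then show "(wirt ^^ Suc a) (\<lambda>z. z *\<^sub>C f n z) z + cnj z *\<^sub>C wirt_bar (?u n) z
      = real (Suc a) *\<^sub>R ?u n z
      + (Re z *\<^sub>R partial_deriv 1 (?u n) z + Im z *\<^sub>R partial_deriv \<i> (?u n) z)"
      unfolding euler_wirtinger by (simp only: add.assoc add.left_commute)
  qed
  show ?case by (rule null_on_radial[OF assms(1) u mult[OF less.prems] radial])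
qed

lemma wirtinger_pow_linear:
  assumes "open V" "z \<in> V" "f \<in> smooth_functions V" "g \<in> smooth_functions V"
  shows "(wirtinger c ^^ a) (\<lambda>z. k *\<^sub>C f z + m *\<^sub>C g z) z
    = k *\<^sub>C (wirtinger c ^^ a) f z + m *\<^sub>C (wirtinger c ^^ a) g z"
  using \<open>z \<in> V\<close>
proof (induction a arbitrary: z)
  case (Suc a)
  let ?f = "(wirtinger c ^^ a) f" and ?g = "(wirtinger c ^^ a) g"
  have f: "?f \<in> smooth_functions V" and g: "?g \<in> smooth_functions V"
    by (rule smooth_wirtinger_pow[OF assms(1,3)], rule smooth_wirtinger_pow[OF assms(1,4)])
  have kf: "(\<lambda>z. k *\<^sub>C ?f z) \<in> smooth_functions V"
    by (rule smooth_linear[OF assms(1) bounded_linear_scaleC f])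
  have mg: "(\<lambda>z. m *\<^sub>C ?g z) \<in> smooth_functions V"
    by (rule smooth_linear[OF assms(1) bounded_linear_scaleC g])
  have "wirtinger c ((wirtinger c ^^ a) (\<lambda>z. k *\<^sub>C f z + m *\<^sub>C g z)) z
      = wirtinger c (\<lambda>z. k *\<^sub>C ?f z + m *\<^sub>C ?g z) z"
    by (rule wirtinger_cong[OF assms(1) Suc.prems smooth_add[OF assms(1) kf mg] Suc.IH[symmetric]])
  also have "\<dots> = k *\<^sub>C wirtinger c ?f z + m *\<^sub>C wirtinger c ?g z"
    unfolding wirtinger_add[OF Suc.prems kf mg] wirtinger_scaleC[OF Suc.prems f]
      wirtinger_scaleC[OF Suc.prems g] ..
  finally show ?case by (simp only: funpow.simps o_apply)
qed simp

lemma partial_deriv_wirtinger: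
  "partial_deriv 1 f z = 1 *\<^sub>C wirt f z + 1 *\<^sub>C wirt_bar f z"
  "partial_deriv \<i> f z = \<i> *\<^sub>C wirt f z + (- \<i>) *\<^sub>C wirt_bar f z"
proof -
  let ?x = "partial_deriv 1 f z" and ?y = "partial_deriv \<i> f z"
  have expand: "k *\<^sub>C wirt f z + m *\<^sub>C wirt_bar f z
    = (k / 2 + m / 2) *\<^sub>C ?x + (- (k * \<i> / 2) + m * \<i> / 2) *\<^sub>C ?y" for k m
  proof -
    have "k *\<^sub>C wirt f z + m *\<^sub>C wirt_bar f z
      = ((k / 2) *\<^sub>C ?x + (- (k * \<i> / 2)) *\<^sub>C ?y) + ((m / 2) *\<^sub>C ?x + (m * \<i> / 2) *\<^sub>C ?y)"
      by (simp add: wirtinger_def scaleC_add_right scaleC_scaleC)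
    then show ?thesis by (simp only: scaleC_add_left ac_simps)
  qed
  show "?x = 1 *\<^sub>C wirt f z + 1 *\<^sub>C wirt_bar f z"
    unfolding expand by (simp add: scaleC_one scaleC_zero_left)
  show "?y = \<i> *\<^sub>C wirt f z + (- \<i>) *\<^sub>C wirt_bar f z"
    unfolding expand by (simp add: scaleC_one scaleC_zero_left)
qed

text \<open>Multiplication by the coordinate has a continuous inverse on its range.  Since the Wirtinger
  derivatives commute, every iterated partial derivative is a combination of derivatives of the form
  treated in \<open>null_on_wirt_pow\<close>; in coinductive form, the sequences all of whose derivatives of that
  form tend to \<open>0\<close> are closed under partial differentiation.\<close>

lemma null_smooth_divide:
  fixes f :: "nat \<Rightarrow> complex \<Rightarrow> 'a::complex_normed_vector"
  assumes "open V" "\<And>n. f n \<in> smooth_functions V" "null_smooth V (\<lambda>n z. z *\<^sub>C f n z)"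
  shows "null_smooth V f"
proof (rule null_smooth_coinduct[OF \<open>open V\<close>])
  let ?F = "{g :: nat \<Rightarrow> complex \<Rightarrow> 'a. (\<forall>n. g n \<in> smooth_functions V) \<and>
    (\<forall>a b. null_on V (\<lambda>n. (wirt ^^ a) ((wirt_bar ^^ b) (g n))))}"
  have "null_on V (\<lambda>n. (wirt ^^ a) ((wirt_bar ^^ b) (f n)))" for a b
  proof (rule null_on_wirt_pow[OF assms(1) smooth_wirtinger_pow[OF assms(1,2)]])
    show "null_smooth V (\<lambda>n z. z *\<^sub>C (wirt_bar ^^ b) (f n) z)"
    proof (induction b)
      case (Suc b)
      from null_smooth_mult_wirt_bar[OF assms(1) smooth_wirtinger_pow[OF assms(1,2)] this]
      show ?case by simp
    qed (simp add: assms(3))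
  qed
  then show "f \<in> ?F" using assms(2) by blast
  fix g assume "g \<in> ?F"
  then have g: "\<And>n. g n \<in> smooth_functions V"
    "\<And>a b. null_on V (\<lambda>n. (wirt ^^ a) ((wirt_bar ^^ b) (g n)))" by blast+
  show "g n \<in> smooth_functions V" for n by (rule g(1))
  show "null_on V g" using g(2)[of 0 0] by simp
  have comb: "(\<lambda>n z. k *\<^sub>C wirt (g n) z + m *\<^sub>C wirt_bar (g n) z) \<in> ?F" for k m
  proof (intro CollectI conjI allI)
    show "(\<lambda>z. k *\<^sub>C wirt (g n) z + m *\<^sub>C wirt_bar (g n) z) \<in> smooth_functions V" for n
      by (rule smooth_add[OF assms(1)
            smooth_linear[OF assms(1) bounded_linear_scaleC smooth_wirtinger[OF assms(1) g(1)]]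
            smooth_linear[OF assms(1) bounded_linear_scaleC smooth_wirtinger[OF assms(1) g(1)]]])
    fix a b
    from null_on_add[OF null_on_linear[OF g(2)[of "Suc a" b] bounded_linear_scaleC[of k]]
        null_on_linear[OF g(2)[of a "Suc b"] bounded_linear_scaleC[of m]]]
    show "null_on V (\<lambda>n. (wirt ^^ a) ((wirt_bar ^^ b)
        (\<lambda>z. k *\<^sub>C wirt (g n) z + m *\<^sub>C wirt_bar (g n) z)))"
    proof (rule null_on_cong)
      fix n z assume z: "z \<in> V"
      let ?p = "wirt ((wirt_bar ^^ b) (g n))" and ?q = "(wirt_bar ^^ Suc b) (g n)"
      have p: "?p \<in> smooth_functions V" and q: "?q \<in> smooth_functions V"
        by (rule smooth_wirtinger[OF assms(1) smooth_wirtinger_pow[OF assms(1) g(1)]],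
            rule smooth_wirtinger_pow[OF assms(1) g(1)])
      have pq: "(\<lambda>z. k *\<^sub>C ?p z + m *\<^sub>C ?q z) \<in> smooth_functions V"
        by (rule smooth_add[OF assms(1) smooth_linear[OF assms(1) bounded_linear_scaleC p]
              smooth_linear[OF assms(1) bounded_linear_scaleC q]])
      have inner: "k *\<^sub>C ?p w + m *\<^sub>C ?q w
        = (wirt_bar ^^ b) (\<lambda>z. k *\<^sub>C wirt (g n) z + m *\<^sub>C wirt_bar (g n) z) w" if "w \<in> V" for w
        unfolding wirtinger_pow_linear[OF assms(1) that smooth_wirtinger[OF assms(1) g(1)]
            smooth_wirtinger[OF assms(1) g(1)]]
          wirtinger_pow_commute[OF assms(1) that g(1)]
        by (simp only: funpow.simps o_apply)
      have "(wirt ^^ Suc a) ((wirt_bar ^^ b) (g n)) z = (wirt ^^ a) ?p z"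
        by (simp only: funpow_Suc_right o_apply)
      then show "k *\<^sub>C (wirt ^^ Suc a) ((wirt_bar ^^ b) (g n)) z + m *\<^sub>C (wirt ^^ a) ?q z
        = (wirt ^^ a) ((wirt_bar ^^ b) (\<lambda>z. k *\<^sub>C wirt (g n) z + m *\<^sub>C wirt_bar (g n) z)) z"
        using wirtinger_pow_cong[OF assms(1) z pq inner] wirtinger_pow_linear[OF assms(1) z p q]
        by (simp only:)
    qed
  qed
  fix v :: complex assume "v \<in> {1, \<i>}"
  then consider "v = 1" | "v = \<i>" by blast
  then show "\<exists>g'\<in>?F. \<forall>n. \<forall>z\<in>V. partial_deriv v (g n) z = g' n z"
  proof cases
    case 1
    show ?thesis
      by (rule bexI[OF _ comb[of 1 1]], intro allI ballI, unfold 1, rule partial_deriv_wirtinger(1))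
  next
    case 2
    show ?thesis
      by (rule bexI[OF _ comb[of \<i> "- \<i>"]], intro allI ballI, unfold 2,
          rule partial_deriv_wirtinger(2))
  qed
qed

section \<open>Transferring property beta-epsilon\<close>

lemma bounded_clinearD:
  assumes "bounded_clinear T"
  shows "bounded_linear T" "T (c *\<^sub>C x) = c *\<^sub>C T x" "T (x - y) = T x - T y"
  using assms linear_simps(2)[of T x y] by (auto simp: bounded_clinear_def)

lemma bounded_clinear_compose:
  "bounded_clinear S \<Longrightarrow> bounded_clinear T \<Longrightarrow> bounded_clinear (S \<circ> T)"
  unfolding bounded_clinear_def by (auto simp: o_def intro: bounded_linear_compose)

lemma bounded_clinear_funpow:
  fixes T :: "'a::complex_normed_vector \<Rightarrow> 'a"
  assumes "bounded_clinear T"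
  shows "bounded_clinear (T ^^ k)"
proof (induction k)
  case 0
  show ?case unfolding funpow.simps id_def bounded_clinear_def by (simp add: bounded_linear_ident)
next
  case (Suc k)
  show ?case unfolding funpow.simps by (rule bounded_clinear_compose[OF assms Suc])
qed

lemma null_smooth_minus:
  assumes "open V" "null_smooth V f" "null_smooth V g"
  shows "null_smooth V (\<lambda>n z. f n z - g n z)"
  using null_smooth_add[OF assms(1,2)
      null_smooth_linear[OF assms(1,3) bounded_linear_minus[OF bounded_linear_ident]]] by simp

lemma smooth_minus:
  assumes "open V" "f \<in> smooth_functions V" "g \<in> smooth_functions V"
  shows "(\<lambda>z. f z - g z) \<in> smooth_functions V"
  using smooth_add[OF assms(1,2)
      smooth_linear[OF assms(1) bounded_linear_minus[OF bounded_linear_ident] assms(3)]] by simp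

text \<open>Modulo the null sequence \<open>(T - z) f\<close>, an application of \<open>T\<close> is a multiplication by \<open>z\<close>, which can
  be cancelled.\<close>

lemma null_smooth_of_power:
  fixes T :: "'a::complex_normed_vector \<Rightarrow> 'a"
  assumes "open V" and T: "bounded_clinear T" and f: "\<And>n. f n \<in> smooth_functions V"
    and res: "null_smooth V (\<lambda>n z. T (f n z) - z *\<^sub>C f n z)"
    and pow: "null_smooth V (\<lambda>n z. (T ^^ k) (f n z))"
  shows "null_smooth V f"
  using pow
proof (induction k)
  case (Suc k)
  note Tk = bounded_clinearD[OF bounded_clinear_funpow[OF T, of k]]
  have "null_smooth V (\<lambda>n z. (T ^^ Suc k) (f n z) - (T ^^ k) (T (f n z) - z *\<^sub>C f n z))"
    by (rule null_smooth_minus[OF assms(1) Suc.prems null_smooth_linear[OF assms(1) res Tk(1)]])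
  moreover have "(T ^^ Suc k) x - (T ^^ k) (T x - z *\<^sub>C x) = z *\<^sub>C (T ^^ k) x" for x z
    by (simp only: Tk(2,3) funpow_Suc_right o_apply diff_diff_eq2 add_diff_cancel_left')
  ultimately have "null_smooth V (\<lambda>n z. z *\<^sub>C (T ^^ k) (f n z))" by (simp only:)
  then have "null_smooth V (\<lambda>n z. (T ^^ k) (f n z))"
    by (rule null_smooth_divide[OF assms(1) smooth_linear[OF assms(1) Tk(1) f]])
  then show ?case by (rule Suc.IH)
qed simp

lemma property_beta_eps_at_iff:
  "property_beta_eps_at T w \<longleftrightarrow> (\<exists>r>0. \<forall>V. open V \<and> V \<subseteq> ball w r \<longrightarrow>
    (\<forall>f. (\<forall>n. f n \<in> smooth_functions V) \<longrightarrow>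
      smooth_tendsto V (\<lambda>n \<mu>. T (f n \<mu>) - \<mu> *\<^sub>C f n \<mu>) (\<lambda>_. 0) \<longrightarrow> null_smooth V f))"
  by (simp add: property_beta_eps_at_def null_smooth_iff)

text \<open>The intertwiner \<open>S\<close> maps approximate eigenfunctions of \<open>T\<close> to approximate eigenfunctions of
  \<open>R\<close>, and \<open>W\<close> keeps the information lost by \<open>S\<close> down to a power of \<open>T\<close>.  The radius that works for
  \<open>R\<close> works for \<open>T\<close>.\<close>

lemma property_beta_eps_at_transfer:
  fixes R :: "'x::complex_normed_vector \<Rightarrow> 'x" and T :: "'y::complex_normed_vector \<Rightarrow> 'y"
  assumes T: "bounded_clinear T" and S: "bounded_clinear S" and W: "bounded_clinear W"
    and intertwine: "\<And>y. R (S y) = S (T y)"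
    and factor: "\<And>y. W (S y) = (T ^^ k) y"
    and R: "property_beta_eps_at R w"
  shows "property_beta_eps_at T w"
proof -
  obtain r where r: "r > 0" and beta: "\<forall>V. open V \<and> V \<subseteq> ball w r \<longrightarrow>
      (\<forall>f. (\<forall>n. f n \<in> smooth_functions V) \<longrightarrow>
        smooth_tendsto V (\<lambda>n \<mu>. R (f n \<mu>) - \<mu> *\<^sub>C f n \<mu>) (\<lambda>_. 0) \<longrightarrow> null_smooth V f)"
    using R[unfolded property_beta_eps_at_iff] by (elim exE conjE) (rule that)
  have main: "null_smooth V f" if V: "open V" "V \<subseteq> ball w r" and f: "\<And>n. f n \<in> smooth_functions V"
    and tends: "smooth_tendsto V (\<lambda>n \<mu>. T (f n \<mu>) - \<mu> *\<^sub>C f n \<mu>) (\<lambda>_. 0)" for V f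
  proof -
    have "(\<lambda>z. T (f n z) - z *\<^sub>C f n z) \<in> smooth_functions V" for n
      by (rule smooth_minus[OF V(1) smooth_linear[OF V(1) bounded_clinearD(1)[OF T] f]
            smooth_mult[OF V(1) f]])
    then have res: "null_smooth V (\<lambda>n z. T (f n z) - z *\<^sub>C f n z)"
      using tends by (simp add: null_smooth_iff)
    have "S (T x - z *\<^sub>C x) = R (S x) - z *\<^sub>C S x" for x z
      by (simp only: bounded_clinearD[OF S] intertwine)
    with null_smooth_linear[OF V(1) res bounded_clinearD(1)[OF S]]
    have "null_smooth V (\<lambda>n z. R (S (f n z)) - z *\<^sub>C S (f n z))" by (simp only:)
    then have "smooth_tendsto V (\<lambda>n z. R (S (f n z)) - z *\<^sub>C S (f n z)) (\<lambda>_. 0)"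
      by (simp add: null_smooth_iff)
    with beta V smooth_linear[OF V(1) bounded_clinearD(1)[OF S] f]
    have "null_smooth V (\<lambda>n z. S (f n z))" by (simp only: simp_thms)
    from null_smooth_linear[OF V(1) this bounded_clinearD(1)[OF W]]
    have "null_smooth V (\<lambda>n z. (T ^^ k) (f n z))" by (simp only: factor)
    then show ?thesis by (rule null_smooth_of_power[OF V(1) T f res])
  qed
  show ?thesis
    unfolding property_beta_eps_at_iff
    by (intro exI[of _ r] conjI r allI impI, elim conjE, rule main) (assumption | erule spec)+
qed

theorem theorem2p6:
  fixes A :: "'x::complex_banach \<Rightarrow> 'y::complex_banach"
    and B C :: "'y \<Rightarrow> 'x"
  assumes "bounded_clinear A" and "bounded_clinear B" and "bounded_clinear C"
    and "A \<circ> (B \<circ> A) ^^ 2 = A \<circ> B \<circ> A \<circ> C \<circ> A"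
    and "A \<circ> B \<circ> A \<circ> C \<circ> A = A \<circ> C \<circ> A \<circ> B \<circ> A"
    and "A \<circ> C \<circ> A \<circ> B \<circ> A = (A \<circ> C) ^^ 2 \<circ> A"
  shows "sigma_beta_eps (A \<circ> C) = sigma_beta_eps (B \<circ> A)
    \<and> (property_beta_eps (A \<circ> C) \<longleftrightarrow> property_beta_eps (B \<circ> A))"
proof -
  have ABABA: "A (B (A (B (A x)))) = A (B (A (C (A x))))" for x
    using fun_cong[OF assms(4), of x] by (simp add: numeral_2_eq_2)
  have ABACA: "A (B (A (C (A x)))) = A (C (A (B (A x))))" for x
    using fun_cong[OF assms(5), of x] by simp
  have ACABA: "A (C (A (B (A x)))) = A (C (A (C (A x))))" for x
    using fun_cong[OF assms(6), of x] by (simp add: numeral_2_eq_2)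
  note compose = bounded_clinear_compose
  note A = assms(1) and B = assms(2) and C = assms(3)
  have "property_beta_eps_at (A \<circ> C) w \<longleftrightarrow> property_beta_eps_at (B \<circ> A) w" for w
  proof
    show "property_beta_eps_at (B \<circ> A) w" if "property_beta_eps_at (A \<circ> C) w"
      by (rule property_beta_eps_at_transfer[where k = 2, OF compose[OF B A]
            compose[OF A compose[OF B A]] B _ _ that])
        (simp_all add: ABABA ABACA numeral_2_eq_2)
    show "property_beta_eps_at (A \<circ> C) w" if "property_beta_eps_at (B \<circ> A) w"
      by (rule property_beta_eps_at_transfer[where k = 3, OF compose[OF A C]
            compose[OF B compose[OF A compose[OF C compose[OF A C]]]] A _ _ that])
        (simp_all add: ABABA ABACA ACABA numeral_3_eq_3)
  qed
  then show ?thesis by (simp add: sigma_beta_eps_def property_beta_eps_def)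
qed

end
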